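(* Let $f:\mathbb{R}^m\to\mathbb{R}$ be convex and differentiable with Lipschitz continuous gradient with constant $L>0$, attaining its minimum over $\mathbb{R}^m$ at a point $x^*$, and let $f^*=f(x^* )=\min_{x\in\mathbb{R}^m} f(x)$. Let $f^\delta(x)=f(x)+\tilde\delta(x)$ with $|\tilde\delta(x)|\le\delta$ for all $x$, let $\mu>0$, let $x_0\in\mathbb{R}^m$ and let $R>0$ satisfy $\|x_0-x^*\|_2\le R$. Let the random sequence $(x_k)_{k\ge 0}$ be generated by $$x_{k+1}=\Pi_X\big(x_k-h\,g_\mu^\delta(x_k)\big),\qquad g_\mu^\delta(x_k)=\frac{m}{\mu}\big(f^\delta(x_k+\mu s_k)-f^\delta(x_k)\big)s_k,$$ with stepsize $h=\frac{1}{8mL}$, where $X=\{x\in\mathbb{R}^m:\|x-x_0\|_2\le 2R\}$ and $s_0,s_1,\dots$ are independent random vectors uniformly distributed on the unit Euclidean sphere of $\mathbb{R}^m$. Let $\psi_0=f(x_0)$ and, for $k\ge1$, $\psi_k=\mathbb{E}_{\mathcal{U}_{k-1}} f(x_k)$, the expectation over $\mathcal{U}_{k-1}=(s_0,\dots,s_{k-1})$. Then for any integer $M\ge 0$, $$\frac{1}{M+1}\sum_{i=0}^M(\psi_i-f^* )\le \frac{8mLR^2}{M+1}+\frac{\mu^2L(m+8)}{8}+\frac{8\delta mR}{\mu}+\frac{\delta^2 m}{L\mu^2}.$$ If, moreover, $f$ is strongly convex with constant $\tau>0$, then $$\psi_M-f^*\le\frac12 L\left(\delta_\mu+\left(1-\frac{\tau}{16mL}\right)^M(R^2-\delta_\mu)\right),$$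 where $$\delta_\mu=\frac{\mu^2L(m+8)}{4\tau}+\frac{16m\delta R}{\tau\mu}+\frac{2m\delta^2}{\tau\mu^2L}.$$
   Context: Lipschitz continuity of the gradient with constant $L$ is used in the form $|f(x)-f(y)-\langle\nabla f(y),x-y\rangle|\le\frac L2\|x-y\|_2^2$ for all $x,y\in\mathbb{R}^m$. The function $f^\delta$ is an inexact zeroth-order oracle for $f$: the error $\tilde\delta:\mathbb{R}^m\to\mathbb{R}$ is a (Borel measurable) function, otherwise unknown, bounded in absolute value by $\delta\ge 0$. $\Pi_X$ denotes Euclidean projection onto $X$. A smooth function $f$ is strongly convex with parameter $\tau$ if $f(x)\ge f(y)+\langle\nabla f(y),x-y\rangle+\frac\tau2\|x-y\|_2^2$ for all $x,y\in\mathbb{R}^m$. *)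

theory Defs
  imports "HOL-Probability.Probability"
begin

text \<open>Normalizing a uniformly distributed point of the unit ball yields the normalized surface
  measure of the unit sphere: the measure of a Borel set \<open>A\<close> of directions is the fraction of the
  volume of the ball that is occupied by the cone over \<open>A\<close>. The origin is a null set.\<close>

definition uniform_sphere :: "'a::euclidean_space measure" where
  "uniform_sphere = distr (uniform_measure lborel (ball 0 1)) borel (\<lambda>u. u /\<^sub>R norm u)"

lemma prob_space_uniform_sphere: "prob_space (uniform_sphere :: 'a::euclidean_space measure)"
  unfolding uniform_sphere_def
proof (rule prob_space.prob_space_distr)
  have "emeasure lborel (ball 0 1 :: 'a set) \<noteq> 0"
    using content_ball_pos[of 1 "0::'a"] by (auto simp: measure_def)
  then show "prob_space (uniform_measure lborel (ball 0 1 :: 'a set))"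
    using emeasure_lborel_ball_finite[of "0::'a" 1] by (intro prob_space_uniform_measure) auto
  show "(\<lambda>u::'a. u /\<^sub>R norm u) \<in> uniform_measure lborel (ball 0 1) \<rightarrow>\<^sub>M borel"
    by simp
qed

lemma AE_uniform_sphere: "AE s in (uniform_sphere :: 'a::euclidean_space measure). norm s = 1"
proof -
  have "AE u in uniform_measure lborel (ball 0 1 :: 'a set). u \<noteq> 0"
    by (rule AE_uniform_measureI) (auto intro: AE_mp[OF AE_lborel_singleton[of 0]])
  then have "AE u in uniform_measure lborel (ball 0 1 :: 'a set). norm (u /\<^sub>R norm u) = 1"
    by eventually_elim simp
  then show ?thesis
    unfolding uniform_sphere_def by (subst AE_distr_iff) auto
qed

text \<open>The finite-difference gradient estimator along the direction \<open>s\<close>; \<open>F\<close> is the inexact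
  oracle, which is evaluated at both points.\<close>

definition zo_gradient ::
    "real \<Rightarrow> (real ^ 'm \<Rightarrow> real) \<Rightarrow> real ^ 'm \<Rightarrow> real ^ 'm \<Rightarrow> real ^ 'm" where
  "zo_gradient \<mu> F x s = (real CARD('m) / \<mu> * (F (x + \<mu> *\<^sub>R s) - F x)) *\<^sub>R s"

lemma gderiv_along_line:
  fixes f :: "'a::real_inner \<Rightarrow> real"
  assumes "\<And>y. GDERIV f y :> g y"
  shows "((\<lambda>t. f (a + t *\<^sub>R d)) has_field_derivative g (a + t *\<^sub>R d) \<bullet> d) (at t)"
proof -
  have 1: "((\<lambda>t. a + t *\<^sub>R d) has_derivative (\<lambda>t. t *\<^sub>R d)) (at t)"
    by (auto intro!: derivative_eq_intros)
  have 2: "(f has_derivative (\<lambda>h. h \<bullet> g (a + t *\<^sub>R d))) (at (a + t *\<^sub>R d))"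
    using assms by (simp add: gderiv_def)
  show ?thesis
    using has_derivative_compose[OF 1 2]
    by (simp add: has_field_derivative_def inner_commute mult.commute[of _ "d \<bullet> _"] mult_commute_abs)
qed

lemma lipschitz_gradient_imp_quadratic_bound:
  fixes f :: "'a::real_inner \<Rightarrow> real"
  assumes g: "\<And>y. GDERIV f y :> g y" and lip: "L-lipschitz_on UNIV g"
  shows "\<bar>f x - f y - g y \<bullet> (x - y)\<bar> \<le> L / 2 * (norm (x - y))\<^sup>2"
proof -
  define d where "d = x - y"
  have bound: "\<bar>g (y + t *\<^sub>R d) \<bullet> d - g y \<bullet> d\<bar> \<le> L * t * (norm d)\<^sup>2" if "t \<ge> 0" for t
  proof -
    have "\<bar>g (y + t *\<^sub>R d) \<bullet> d - g y \<bullet> d\<bar> \<le> norm (g (y + t *\<^sub>R d) - g y) * norm d"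
      by (metis inner_diff_left Cauchy_Schwarz_ineq2)
    also have "\<dots> \<le> (L * norm (t *\<^sub>R d)) * norm d"
      using lipschitz_onD[OF lip, of "y + t *\<^sub>R d" y] by (intro mult_right_mono) (auto simp: dist_norm)
    finally show ?thesis using that by (simp add: power2_eq_square mult_ac)
  qed
  note D = gderiv_along_line[of f g y d, OF g]
  have "f (y + 1 *\<^sub>R d) - 1 * (g y \<bullet> d) - L / 2 * 1\<^sup>2 * (norm d)\<^sup>2
      \<le> f (y + 0 *\<^sub>R d) - 0 * (g y \<bullet> d) - L / 2 * 0\<^sup>2 * (norm d)\<^sup>2"
  proof (rule DERIV_nonpos_imp_nonincreasing[of 0 1])
    fix t :: real assume "0 \<le> t" "t \<le> 1"
    have "((\<lambda>t. f (y + t *\<^sub>R d) - t * (g y \<bullet> d) - L / 2 * t\<^sup>2 * (norm d)\<^sup>2) has_field_derivative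
        g (y + t *\<^sub>R d) \<bullet> d - g y \<bullet> d - L * t * (norm d)\<^sup>2) (at t)"
      by (auto intro!: derivative_eq_intros D)
    moreover have "g (y + t *\<^sub>R d) \<bullet> d - g y \<bullet> d - L * t * (norm d)\<^sup>2 \<le> 0"
      using bound[OF \<open>0 \<le> t\<close>] by linarith
    ultimately show "\<exists>D. ((\<lambda>t. f (y + t *\<^sub>R d) - t * (g y \<bullet> d) - L / 2 * t\<^sup>2 * (norm d)\<^sup>2)
        has_field_derivative D) (at t) \<and> D \<le> 0" by blast
  qed simp
  moreover have "f (y + 0 *\<^sub>R d) - 0 * (g y \<bullet> d) + L / 2 * 0\<^sup>2 * (norm d)\<^sup>2
      \<le> f (y + 1 *\<^sub>R d) - 1 * (g y \<bullet> d) + L / 2 * 1\<^sup>2 * (norm d)\<^sup>2"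
  proof (rule DERIV_nonneg_imp_nondecreasing[of 0 1])
    fix t :: real assume "0 \<le> t" "t \<le> 1"
    have "((\<lambda>t. f (y + t *\<^sub>R d) - t * (g y \<bullet> d) + L / 2 * t\<^sup>2 * (norm d)\<^sup>2) has_field_derivative
        g (y + t *\<^sub>R d) \<bullet> d - g y \<bullet> d + L * t * (norm d)\<^sup>2) (at t)"
      by (auto intro!: derivative_eq_intros D)
    moreover have "g (y + t *\<^sub>R d) \<bullet> d - g y \<bullet> d + L * t * (norm d)\<^sup>2 \<ge> 0"
      using bound[OF \<open>0 \<le> t\<close>] by linarith
    ultimately show "\<exists>D. ((\<lambda>t. f (y + t *\<^sub>R d) - t * (g y \<bullet> d) + L / 2 * t\<^sup>2 * (norm d)\<^sup>2)
        has_field_derivative D) (at t) \<and> D \<ge> 0" by blast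
  qed simp
  ultimately show ?thesis unfolding d_def abs_le_iff by simp
qed

lemma quadratic_bound_imp_lipschitz_gradient:
  fixes f :: "'a::real_inner \<Rightarrow> real"
  assumes conv: "convex_on UNIV f" and g: "\<And>y. GDERIV f y :> g y" and L: "L > 0"
    and bound: "\<And>x y. \<bar>f x - f y - g y \<bullet> (x - y)\<bar> \<le> L / 2 * (norm (x - y))\<^sup>2"
  shows "L-lipschitz_on UNIV g"
proof (rule lipschitz_onI)
  have tangent: "f z \<ge> f x + g x \<bullet> (z - x)" for x z
  proof -
    have "convex_on UNIV (\<lambda>t. f (x + t *\<^sub>R (z - x)))"
    proof (rule convex_onI)
      fix t u v :: real assume t: "0 < t" "t < 1"
      have "x + ((1 - t) *\<^sub>R u + t *\<^sub>R v) *\<^sub>R (z - x)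
          = (1 - t) *\<^sub>R (x + u *\<^sub>R (z - x)) + t *\<^sub>R (x + v *\<^sub>R (z - x))"
        by (simp add: algebra_simps)
      then show "f (x + ((1 - t) *\<^sub>R u + t *\<^sub>R v) *\<^sub>R (z - x))
          \<le> (1 - t) * f (x + u *\<^sub>R (z - x)) + t * f (x + v *\<^sub>R (z - x))"
        using convex_onD[OF conv, of t] t by simp
    qed simp
    from convex_on_imp_above_tangent[OF this, of 0 1] gderiv_along_line[of f g x "z - x" 0, OF g]
    show ?thesis by fastforce
  qed
  have cocoercive: "f x + g x \<bullet> (y - x) + (norm (g y - g x))\<^sup>2 / (2 * L) \<le> f y" for x y
  proof -
    define e where "e = g y - g x"
    define z where "z = y - (1 / L) *\<^sub>R e"
    have "f x + g x \<bullet> (z - x) \<le> f y + g y \<bullet> (z - y) + L / 2 * (norm (z - y))\<^sup>2"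
      using tangent[of x z] bound[of z y] by linarith
    moreover have "g x \<bullet> (z - x) = g x \<bullet> (y - x) - (g x \<bullet> e) / L"
      by (simp add: z_def algebra_simps)
    moreover have "g y \<bullet> (z - y) = - (g y \<bullet> e) / L"
      by (simp add: z_def algebra_simps)
    moreover have "L / 2 * (norm (z - y))\<^sup>2 = (norm e)\<^sup>2 / (2 * L)"
      using L by (simp add: z_def power2_eq_square field_simps)
    moreover have "(g y \<bullet> e) / L - (g x \<bullet> e) / L = (norm e)\<^sup>2 / L"
      by (simp add: e_def power2_norm_eq_inner inner_diff_left diff_divide_distrib)
    ultimately show ?thesis by (simp add: e_def[symmetric])
  qed
  fix x y
  have "(norm (g x - g y))\<^sup>2 / L \<le> (g x - g y) \<bullet> (x - y)"
    using cocoercive[of x y] cocoercive[of y x]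
    by (simp add: norm_minus_commute algebra_simps)
  also have "\<dots> \<le> norm (g x - g y) * norm (x - y)"
    by (rule norm_cauchy_schwarz)
  finally have "norm (g x - g y) * norm (g x - g y) \<le> norm (g x - g y) * (L * norm (x - y))"
    using L by (simp add: field_simps power2_eq_square)
  then show "dist (g x) (g y) \<le> L * dist x y"
    using L by (cases "g x = g y") (auto simp: dist_norm mult_le_cancel_left_pos)
qed (use L in simp)

text \<open>For convex functions, Lipschitz continuity of the gradient is the same as the two-sided
  quadratic bound, with the same constant.\<close>

lemma lipschitz_gradient_iff_quadratic_bound:
  fixes f :: "'a::real_inner \<Rightarrow> real"
  assumes "convex_on UNIV f" "\<And>y. GDERIV f y :> g y" "L > 0"
  shows "L-lipschitz_on UNIV g \<longleftrightarrow>
    (\<forall>x y. \<bar>f x - f y - g y \<bullet> (x - y)\<bar> \<le> L / 2 * (norm (x - y))\<^sup>2)"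
  using lipschitz_gradient_imp_quadratic_bound[of f g L] assms
    quadratic_bound_imp_lipschitz_gradient[of f g L] by blast

end

theory Submission
  imports Defs
begin

text \<open>The estimator is an expected gradient: by the divergence theorem on the unit ball,
  \<open>m / \<mu>\<close> times the spherical mean of \<open>f (x + \<mu> s) s\<close> is the mean of \<open>\<nabla>f (x + \<mu> u)\<close> over the
  ball, and for convex \<open>f\<close> each of these gradients satisfies
  \<open>\<nabla>f z \<bullet> (x - x\<^sup>*) \<ge> f x - f x\<^sup>* - (L / 2) \<parallel>x - z\<parallel>\<^sup>2\<close>. As \<open>s\<close> is centred, the noise at \<open>x\<close> itself
  cancels, so the noise contributes a bias of at most \<open>(m / \<mu>) \<delta> \<parallel>x - x\<^sup>*\<parallel>\<close>, where
  \<open>\<parallel>x - x\<^sup>*\<parallel> \<le> 3 R\<close> on \<open>X\<close>. The second moment of the estimator is at most \<open>8 m L (f x - f x\<^sup>*)\<close> plus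
  errors, and the stepsize \<open>1 / (8 m L)\<close> lets half of the descent absorb it. Since \<open>x\<^sub>k\<close> and \<open>s\<^sub>k\<close> are
  independent, this gives a recursion for the mean of \<open>\<parallel>x\<^sub>k - x\<^sup>*\<parallel>\<^sup>2\<close>.\<close>

section \<open>The divergence theorem on the unit ball\<close>

lemma lipschitz_on_mult:
  fixes f g :: "'a::metric_space \<Rightarrow> real"
  assumes f: "K-lipschitz_on X f" and g: "K'-lipschitz_on X g"
    and B: "\<And>x. x \<in> X \<Longrightarrow> \<bar>f x\<bar> \<le> B" and B': "\<And>x. x \<in> X \<Longrightarrow> \<bar>g x\<bar> \<le> B'"
    and "0 \<le> B" "0 \<le> B'"
  shows "(B * K' + B' * K)-lipschitz_on X (\<lambda>x. f x * g x)"
proof (rule lipschitz_onI)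
  fix x y assume xy: "x \<in> X" "y \<in> X"
  have "f x * g x - f y * g y = f x * (g x - g y) + g y * (f x - f y)"
    by (simp add: algebra_simps)
  then have "\<bar>f x * g x - f y * g y\<bar> \<le> \<bar>f x\<bar> * \<bar>g x - g y\<bar> + \<bar>g y\<bar> * \<bar>f x - f y\<bar>"
    by (metis abs_mult abs_triangle_ineq)
  also have "\<dots> \<le> B * (K' * dist x y) + B' * (K * dist x y)"
    using lipschitz_onD[OF f xy] lipschitz_onD[OF g xy] B B' xy \<open>0 \<le> B\<close> \<open>0 \<le> B'\<close>
    by (intro add_mono mult_mono) (auto simp: dist_real_def)
  finally show "dist (f x * g x) (f y * g y) \<le> (B * K' + B' * K) * dist x y"
    by (simp add: dist_real_def algebra_simps)
qed (use assms lipschitz_on_nonneg[OF f] lipschitz_on_nonneg[OF g] in auto)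

lemma lipschitz_on_clamp:
  fixes f :: "'a::metric_space \<Rightarrow> real"
  assumes "K-lipschitz_on X f"
  shows "K-lipschitz_on X (\<lambda>x. min 1 (max 0 (f x)))"
proof (rule lipschitz_onI)
  fix x y assume "x \<in> X" "y \<in> X"
  then have "\<bar>f x - f y\<bar> \<le> K * dist x y"
    using lipschitz_onD[OF assms, of x y] by (simp add: dist_real_def)
  then show "dist (min 1 (max 0 (f x))) (min 1 (max 0 (f y))) \<le> K * dist x y"
    unfolding dist_real_def by linarith
qed (rule lipschitz_on_nonneg[OF assms])

text \<open>The continuous gradient is bounded on the compact ball, and the ball is convex, so the
  mean value inequality applies.\<close>

lemma C1_imp_lipschitz_on_cball:
  fixes f :: "'a::euclidean_space \<Rightarrow> real"
  assumes g: "\<And>y. GDERIV f y :> g y" and cont: "continuous_on UNIV g"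
  shows "\<exists>K. K-lipschitz_on (cball 0 r) f"
proof -
  have "bounded (g ` cball 0 r)"
    by (intro compact_imp_bounded compact_continuous_image continuous_on_subset[OF cont]) auto
  then obtain K where K: "K > 0" "\<And>y. y \<in> cball 0 r \<Longrightarrow> norm (g y) \<le> K"
    unfolding bounded_pos by blast
  have "K-lipschitz_on (cball 0 r) f"
  proof (rule bounded_derivative_imp_lipschitz)
    fix y :: 'a assume "y \<in> cball 0 r"
    show "(f has_derivative (\<lambda>h. h \<bullet> g y)) (at y within cball 0 r)"
      using g[of y] unfolding gderiv_def by (rule has_derivative_at_withinI)
    show "onorm (\<lambda>h. h \<bullet> g y) \<le> K"
    proof (rule onorm_le)
      fix h :: 'a
      have "norm (h \<bullet> g y) \<le> norm h * norm (g y)"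
        by (simp add: Cauchy_Schwarz_ineq2)
      also have "\<dots> \<le> norm h * K"
        by (intro mult_left_mono K(2) \<open>y \<in> cball 0 r\<close> norm_ge_zero)
      finally show "norm (h \<bullet> g y) \<le> K * norm h" by (simp add: mult.commute)
    qed
  qed (use K in auto)
  then show ?thesis ..
qed

lemma GDERIV_imp_continuous_on:
  assumes "\<And>y. GDERIV f y :> g y"
  shows "continuous_on S f"
  using assms unfolding gderiv_def
  by (meson continuous_at_imp_continuous_on has_derivative_continuous)

lemma integral_lborel_translate:
  fixes G :: "'a::euclidean_space \<Rightarrow> real"
  assumes [measurable]: "G \<in> borel_measurable borel"
  shows "(LINT u|lborel. G (u + d)) = integral\<^sup>L lborel G"
proof -
  have "integral\<^sup>L lborel G = integral\<^sup>L (distr lborel borel ((+) d)) G"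
    by (simp add: lborel_distr_plus)
  also have "\<dots> = (LINT u|lborel. G (d + u))"
    by (rule integral_distr) auto
  finally show ?thesis by (simp add: add.commute)
qed

lemma integrable_lborel_bounded_support:
  fixes G :: "'a::euclidean_space \<Rightarrow> real"
  assumes [measurable]: "G \<in> borel_measurable borel"
    and "\<And>u. \<bar>G u\<bar> \<le> K * indicator (cball 0 r) u"
  shows "integrable lborel G"
proof (rule Bochner_Integration.integrable_bound)
  show "integrable lborel (\<lambda>u. K * indicator (cball (0::'a) r) u)"
    using emeasure_lborel_cball_finite[of "0::'a" r] by auto
  show "AE u in lborel. norm (G u) \<le> norm (K * indicator (cball 0 r) u)"
    using assms(2) by (auto intro!: AE_I2 order_trans[OF assms(2)])
qed auto

text \<open>Difference quotients in direction \<open>v\<close> have integral zero by translation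
  invariance, and the Lipschitz bound dominates them, so the limit passes through the integral.
  Differentiability is assumed only almost everywhere because the function used later contains a
  cutoff with kinks.\<close>

lemma integral_directional_derivative_eq_0:
  fixes G D :: "'a::euclidean_space \<Rightarrow> real"
  assumes lip: "\<And>r. \<exists>K. K-lipschitz_on (cball 0 r) G"
    and supp: "\<And>u. norm u > r \<Longrightarrow> G u = 0"
    and deriv: "AE u in lborel. ((\<lambda>t. G (u + t *\<^sub>R v)) has_field_derivative D u) (at 0)"
    and [measurable]: "D \<in> borel_measurable borel"
  shows "integral\<^sup>L lborel D = 0"
proof -
  have "continuous_on UNIV G"
  proof (intro continuous_at_imp_continuous_on ballI)
    fix u :: 'a
    obtain K where "K-lipschitz_on (cball 0 (norm u + 1)) G" using lip by blast
    then have "continuous_on (ball 0 (norm u + 1)) G"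
      by (rule lipschitz_on_continuous_on[OF lipschitz_on_subset]) auto
    then show "isCont G u"
      using continuous_on_interior[of "ball 0 (norm u + 1)" G u] by (simp add: interior_open)
  qed
  then have [measurable]: "G \<in> borel_measurable borel"
    by (rule borel_measurable_continuous_onI)
  \<comment> \<open>Beyond radius \<open>r'\<close> both \<open>u\<close> and its shift, by at most
    \<open>norm v\<close>, lie outside the support, so every quotient vanishes there. The Lipschitz
    constant belongs to a ball larger by another \<open>norm v\<close>, which contains the shifts of
    the remaining points.\<close>
  define r' where "r' = max r 0 + norm v"
  obtain K where K: "K-lipschitz_on (cball 0 (r' + norm v)) G" using lip by blast
  note K0 = lipschitz_on_nonneg[OF K]
  define Q where "Q n u = real (Suc n) * (G (u + (1 / real (Suc n)) *\<^sub>R v) - G u)" for n u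
  have [measurable]: "Q n \<in> borel_measurable borel" for n
    unfolding Q_def by measurable
  have small: "norm ((1 / real (Suc n)) *\<^sub>R v) \<le> norm v" for n
    by (simp add: divide_le_eq mult_le_cancel_left1)
  have bound: "\<bar>Q n u\<bar> \<le> (K * norm v) * indicator (cball 0 r') u" for n u
  proof (cases "norm u \<le> r'")
    case True
    let ?d = "(1 / real (Suc n)) *\<^sub>R v"
    have "norm (u + ?d) \<le> r' + norm v"
      using True small[of n] norm_triangle_ineq[of u ?d] by linarith
    then have "u + ?d \<in> cball 0 (r' + norm v)" "u \<in> cball 0 (r' + norm v)"
      using True norm_ge_zero[of v] unfolding mem_cball_0 by linarith+
    then have "\<bar>G (u + ?d) - G u\<bar> \<le> K * norm ?d"
      using lipschitz_onD[OF K, of "u + ?d" u] unfolding dist_norm real_norm_def by simp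
    then have "real (Suc n) * \<bar>G (u + ?d) - G u\<bar> \<le> real (Suc n) * (K * norm ?d)"
      by (intro mult_left_mono) auto
    also have "\<dots> = K * norm v" by simp
    finally show ?thesis using True by (simp add: Q_def abs_mult)
  next
    case False
    let ?d = "(1 / real (Suc n)) *\<^sub>R v"
    have "norm (u + ?d) > r" "norm u > r"
      using False small[of n] norm_diff_ineq[of u ?d] norm_ge_zero[of v]
      unfolding r'_def by linarith+
    then show ?thesis using supp by (simp add: Q_def K0)
  qed
  have lim: "(\<lambda>n. Q n u) \<longlonglongrightarrow> D u"
    if "((\<lambda>t. G (u + t *\<^sub>R v)) has_field_derivative D u) (at 0)" for u
  proof -
    have "((\<lambda>t. (G (u + t *\<^sub>R v) - G u) / t) \<longlongrightarrow> D u) (at 0)"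
      using that by (simp add: has_field_derivative_iff)
    moreover have "filterlim (\<lambda>n. 1 / real (Suc n)) (at 0) sequentially"
      unfolding filterlim_at using LIMSEQ_inverse_real_of_nat by (auto simp: inverse_eq_divide)
    ultimately have "(\<lambda>n. (G (u + (1 / real (Suc n)) *\<^sub>R v) - G u) / (1 / real (Suc n))) \<longlonglongrightarrow> D u"
      by (rule filterlim_compose)
    then show ?thesis by (simp add: Q_def mult.commute)
  qed
  have "(\<lambda>n. integral\<^sup>L lborel (Q n)) \<longlonglongrightarrow> integral\<^sup>L lborel D"
  proof (rule integral_dominated_convergence)
    show "integrable lborel (\<lambda>u::'a. (K * norm v) * indicator (cball 0 r') u)"
      using emeasure_lborel_cball_finite[of "0::'a" r'] by auto
    show "AE u in lborel. (\<lambda>n. Q n u) \<longlonglongrightarrow> D u"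
      using deriv by eventually_elim (rule lim)
  qed (use bound in auto)
  moreover have "integral\<^sup>L lborel (Q n) = 0" for n
  proof -
    have "bounded (G ` cball 0 r')"
      using \<open>continuous_on UNIV G\<close>
      by (intro compact_imp_bounded compact_continuous_image continuous_on_subset[OF \<open>continuous_on UNIV G\<close>]) auto
    then obtain B where B: "B > 0" "\<And>u. u \<in> cball 0 r' \<Longrightarrow> \<bar>G u\<bar> \<le> B"
      unfolding bounded_pos real_norm_def by blast
    have G: "integrable lborel G"
    proof (rule integrable_lborel_bounded_support)
      show "\<bar>G u\<bar> \<le> B * indicator (cball 0 r') u" for u
      proof (cases "u \<in> cball 0 r'")
        case False
        then have "norm u > r"
          using norm_ge_zero[of v] unfolding mem_cball_0 r'_def by linarith
        then show ?thesis using B(1) supp by simp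
      qed (use B(2) in simp)
    qed auto
    have G': "integrable lborel (\<lambda>u. G (u + d))" for d
    proof -
      have "integrable (distr lborel borel ((+) d)) G" using G by (simp add: lborel_distr_plus)
      then show ?thesis by (subst (asm) integrable_distr_eq) (auto simp: add.commute)
    qed
    show ?thesis
      unfolding Q_def by (simp add: integral_lborel_translate G G')
  qed
  ultimately show ?thesis
    by (simp add: LIMSEQ_const_iff)
qed

section \<open>Gradients and the radial cutoff\<close>

text \<open>In contrast to \<open>gderiv_along_line\<close>, the gradient has to exist only at
  \<open>u\<close> itself, so this applies to the cutoff away from its kinks.\<close>

lemma GDERIV_line:
  fixes f :: "'a::real_inner \<Rightarrow> real"
  assumes "GDERIV f u :> d"
  shows "((\<lambda>t. f (u + t *\<^sub>R v)) has_field_derivative d \<bullet> v) (at 0)"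
proof -
  have 1: "((\<lambda>t. u + t *\<^sub>R v) has_derivative (\<lambda>t. t *\<^sub>R v)) (at 0)"
    by (auto intro!: derivative_eq_intros)
  have 2: "(f has_derivative (\<lambda>h. h \<bullet> d)) (at (u + 0 *\<^sub>R v))"
    using assms by (simp add: gderiv_def)
  show ?thesis
    using has_derivative_compose[OF 1 2]
    by (simp add: has_field_derivative_def inner_commute mult.commute[of _ "d \<bullet> _"] mult_commute_abs)
qed

lemma GDERIV_inner_left: "GDERIV (\<lambda>u. u \<bullet> w) u :> w"
  unfolding gderiv_def by (auto intro!: derivative_eq_intros)

lemma GDERIV_transform_within_open:
  assumes "GDERIV f x :> d" "open S" "x \<in> S" "\<And>y. y \<in> S \<Longrightarrow> f y = g y"
  shows "GDERIV g x :> d"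
  using assms unfolding gderiv_def by (rule has_derivative_transform_within_open)

lemma AE_lborel_norm_neq: "AE u in lborel. norm (u::'a::euclidean_space) \<noteq> r"
proof -
  have "sphere (0::'a) r \<in> null_sets lborel"
    using negligible_sphere[of "0::'a" r]
    by (auto simp: null_sets_completion_iff negligible_iff_null_sets)
  then have "AE u in lborel. u \<notin> sphere (0::'a) r"
    by (rule AE_not_in)
  then show ?thesis by simp
qed

text \<open>The Lipschitz cutoff interpolates between 1 on the ball of radius \<open>\<rho>\<close> and 0 outside the unit
  ball, linearly in \<open>(norm u)\<^sup>2\<close>; that makes its gradient on the shell a multiple of \<open>u\<close>.\<close>

lemma integral_cutoff_derivative:
  fixes f :: "'a::euclidean_space \<Rightarrow> real"
  assumes g: "\<And>y. GDERIV f y :> g y" and cont: "continuous_on UNIV g"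
    and \<rho>: "0 < \<rho>" "\<rho> < 1"
  defines "a \<equiv> \<lambda>u::'a. min 1 (max 0 ((1 - u \<bullet> u) / (1 - \<rho>\<^sup>2)))"
  shows "(LINT u|lborel. a u * (g u \<bullet> v))
    = 2 / (1 - \<rho>\<^sup>2) * (LINT u|lborel. indicator (ball 0 1 - ball 0 \<rho>) u * (f u * (u \<bullet> v)))"
proof -
  have pos: "1 - \<rho>\<^sup>2 > 0" using \<rho> by (simp add: power_less_one_iff)
  have contf: "continuous_on UNIV f" by (rule GDERIV_imp_continuous_on[OF g])
  note [measurable] = borel_measurable_continuous_onI[OF contf] borel_measurable_continuous_onI[OF cont]
  have [measurable]: "a \<in> borel_measurable borel" unfolding a_def by measurable
  define S where "S = (ball 0 1 - ball 0 \<rho> :: 'a set)"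
  have [measurable]: "S \<in> sets borel" unfolding S_def by measurable
  \<comment> \<open>By the product rule this is the derivative of \<open>f u * a u\<close> along
    \<open>v\<close> off the two spheres where \<open>a\<close> has kinks. Its integral is zero, and
    splitting that integral gives the claim.\<close>
  define D where "D u = a u * (g u \<bullet> v) - 2 / (1 - \<rho>\<^sup>2) * (indicator S u * (f u * (u \<bullet> v)))" for u
  have a01: "0 \<le> a u" "a u \<le> 1" for u by (auto simp: a_def)
  have a_out: "a u = 0" if "norm u \<ge> 1" for u
    using that pos by (simp add: a_def dot_square_norm divide_le_0_iff)
  have ga: "GDERIV (\<lambda>u. (1 - u \<bullet> u) / (1 - \<rho>\<^sup>2)) y :> (- 2 / (1 - \<rho>\<^sup>2)) *\<^sub>R y" for y :: 'a
    unfolding gderiv_def using pos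
    by (auto intro!: derivative_eq_intros simp: inner_commute)
  have lip_a: "\<exists>K. K-lipschitz_on (cball 0 r) a" for r
  proof -
    have "continuous_on UNIV (\<lambda>y::'a. (- 2 / (1 - \<rho>\<^sup>2)) *\<^sub>R y)" by (intro continuous_intros)
    from C1_imp_lipschitz_on_cball[OF ga this] show ?thesis
      unfolding a_def using lipschitz_on_clamp by blast
  qed
  have "integral\<^sup>L lborel D = 0"
  proof (rule integral_directional_derivative_eq_0[where r = 1 and v = v and G = "\<lambda>u. f u * a u"])
    fix r :: real
    obtain K where K: "K-lipschitz_on (cball 0 r) f"
      using C1_imp_lipschitz_on_cball[OF g cont] by blast
    obtain K' where K': "K'-lipschitz_on (cball 0 r) a" using lip_a by blast
    have "bounded (f ` cball 0 r)"
      by (intro compact_imp_bounded compact_continuous_image continuous_on_subset[OF contf]) auto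
    then obtain B where "B > 0" "\<And>u. u \<in> cball 0 r \<Longrightarrow> \<bar>f u\<bar> \<le> B"
      unfolding bounded_pos real_norm_def by blast
    then have "(B * K' + 1 * K)-lipschitz_on (cball 0 r) (\<lambda>u. f u * a u)"
      using a01 by (intro lipschitz_on_mult K K') auto
    then show "\<exists>K. K-lipschitz_on (cball 0 r) (\<lambda>u. f u * a u)" ..
  next
    show "f u * a u = 0" if "norm u > 1" for u using a_out that by simp
  next
    show "D \<in> borel_measurable borel" unfolding D_def by measurable
  next
    have deriv: "((\<lambda>t. f (u + t *\<^sub>R v) * a (u + t *\<^sub>R v)) has_field_derivative D u) (at 0)"
      if "norm u \<noteq> 1" "norm u \<noteq> \<rho>" for u
    proof -
      have key: "GDERIV a u :> (indicator S u * (- 2 / (1 - \<rho>\<^sup>2))) *\<^sub>R u"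
      proof -
        define b where "b y = (1 - y \<bullet> y) / (1 - \<rho>\<^sup>2)" for y :: 'a
        consider "norm u < \<rho>" | "\<rho> < norm u" "norm u < 1" | "norm u > 1"
          using \<open>norm u \<noteq> 1\<close> \<open>norm u \<noteq> \<rho>\<close> by linarith
        then show ?thesis
        proof cases
          case 1
          have "a y = 1" if "y \<in> ball 0 \<rho>" for y
          proof -
            have "y \<bullet> y \<le> \<rho>\<^sup>2"
              using that by (simp add: dot_square_norm power_mono)
            then show ?thesis using pos by (simp add: a_def)
          qed
          then have "GDERIV a u :> 0"
            using 1 by (intro GDERIV_transform_within_open[OF GDERIV_const, of "ball 0 \<rho>" u 1 a]) auto
          then show ?thesis using 1 by (simp add: S_def)
        next
          case 2
          have "b y = a y" if "y \<in> ball 0 1 - cball 0 \<rho>" for y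
          proof -
            have "y \<bullet> y \<ge> \<rho>\<^sup>2" "y \<bullet> y \<le> 1"
              using that \<rho> by (auto simp: dot_square_norm power_mono abs_square_le_1)
            then show ?thesis using pos by (simp add: a_def b_def)
          qed
          then have "GDERIV a u :> (- 2 / (1 - \<rho>\<^sup>2)) *\<^sub>R u"
            using 2 ga[of u] unfolding b_def[symmetric]
            by (intro GDERIV_transform_within_open[of b u _ "ball 0 1 - cball 0 \<rho>" a]) auto
          then show ?thesis using 2 by (simp add: S_def)
        next
          case 3
          then have "GDERIV a u :> 0"
            using a_out
            by (intro GDERIV_transform_within_open[OF GDERIV_const, of "- cball 0 1" u 0 a]) auto
          then show ?thesis using 3 by (simp add: S_def)
        qed
      qed
      show ?thesis
        using GDERIV_line[OF GDERIV_mult[OF g[of u] key], of v]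
        by (simp add: D_def algebra_simps)
    qed
    show "AE u in lborel. ((\<lambda>t. f (u + t *\<^sub>R v) * a (u + t *\<^sub>R v)) has_field_derivative D u) (at 0)"
      using AE_lborel_norm_neq[of 1] AE_lborel_norm_neq[of \<rho>]
      by eventually_elim (rule deriv)
  qed
  moreover have "integrable lborel (\<lambda>u. a u * (g u \<bullet> v))"
  proof -
    have "bounded ((\<lambda>u. g u \<bullet> v) ` cball 0 1)"
      by (intro compact_imp_bounded compact_continuous_image continuous_intros
        continuous_on_subset[OF cont]) auto
    then obtain B where B: "B > 0" "\<And>u. u \<in> cball 0 1 \<Longrightarrow> \<bar>g u \<bullet> v\<bar> \<le> B"
      unfolding bounded_pos real_norm_def by blast
    have "\<bar>a u * (g u \<bullet> v)\<bar> \<le> B * indicator (cball 0 1) u" for u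
    proof (cases "norm u \<le> 1")
      case True
      then have "\<bar>a u\<bar> * \<bar>g u \<bullet> v\<bar> \<le> 1 * B"
        using a01 B by (intro mult_mono) auto
      then show ?thesis using True by (simp add: abs_mult)
    qed (use a_out in auto)
    then show ?thesis by (intro integrable_lborel_bounded_support) auto
  qed
  moreover have "integrable lborel (\<lambda>u. indicator S u * (f u * (u \<bullet> v)))"
  proof -
    have "bounded ((\<lambda>u. f u * (u \<bullet> v)) ` cball 0 1)"
      by (intro compact_imp_bounded compact_continuous_image continuous_intros
        continuous_on_subset[OF contf]) auto
    then obtain B where B: "B > 0" "\<And>u. u \<in> cball 0 1 \<Longrightarrow> \<bar>f u * (u \<bullet> v)\<bar> \<le> B"
      unfolding bounded_pos real_norm_def by blast
    have "\<bar>indicator S u * (f u * (u \<bullet> v))\<bar> \<le> B * indicator (cball 0 1) u" for u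
      using B(2)[of u] B(1) by (auto simp: S_def indicator_def)
    then show ?thesis by (intro integrable_lborel_bounded_support) auto
  qed
  ultimately show ?thesis
    unfolding D_def by (simp add: S_def)
qed

section \<open>From thin shells to the sphere\<close>

text \<open>The substitution of \<open>\<rho> *\<^sub>R u\<close> for \<open>u\<close> has Jacobian
  \<open>\<rho> ^ DIM('a)\<close> and leaves a function of the direction unchanged.\<close>

lemma integral_ball_scale_homogeneous:
  fixes b :: "'a::euclidean_space \<Rightarrow> real"
  assumes [measurable]: "b \<in> borel_measurable borel" and "\<rho> > 0"
    and homogeneous: "\<And>c u. c > 0 \<Longrightarrow> b (c *\<^sub>R u) = b u"
  shows "(LINT u|lborel. indicator (ball 0 \<rho>) u * b u)
    = \<rho> ^ DIM('a) * (LINT u|lborel. indicator (ball 0 1) u * b u)"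
proof -
  let ?F = "\<lambda>u::'a. indicator (ball 0 \<rho>) u * b u"
  have [measurable]: "?F \<in> borel_measurable borel"
    by (intro borel_measurable_times borel_measurable_indicator) auto
  have "integral\<^sup>L lborel ?F
      = integral\<^sup>L (density (distr lborel borel (\<lambda>u. 0 + \<rho> *\<^sub>R u)) (\<lambda>_. \<bar>\<rho>\<bar> ^ DIM('a))) ?F"
    using lborel_affine[of \<rho> "0::'a"] \<open>\<rho> > 0\<close> by simp
  also have "\<dots> = integral\<^sup>L (distr lborel borel (\<lambda>u. 0 + \<rho> *\<^sub>R u)) (\<lambda>u. \<bar>\<rho>\<bar> ^ DIM('a) * ?F u)"
    by (subst integral_density) auto
  also have "\<dots> = (LINT u|lborel. \<bar>\<rho>\<bar> ^ DIM('a) * ?F (0 + \<rho> *\<^sub>R u))"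
    by (rule integral_distr) auto
  also have "\<dots> = (LINT u|lborel. \<rho> ^ DIM('a) * (indicator (ball 0 1) u * b u))"
    using \<open>\<rho> > 0\<close> homogeneous
    by (intro Bochner_Integration.integral_cong) (auto simp: indicator_def)
  finally show ?thesis by simp
qed

lemma integral_uniform_measure:
  fixes F :: "'a \<Rightarrow> real"
  assumes [measurable]: "A \<in> sets M" "F \<in> borel_measurable M"
    and A: "emeasure M A \<noteq> 0" "emeasure M A \<noteq> \<infinity>"
  shows "integral\<^sup>L (uniform_measure M A) F = (LINT u|M. indicator A u * F u) / measure M A"
proof -
  have pos: "measure M A > 0"
    using A by (simp add: measure_def enn2real_positive_iff less_top zero_less_iff_neq_zero)
  have "uniform_measure M A = density M (\<lambda>u. ennreal (indicator A u / measure M A))"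
    unfolding uniform_measure_def using pos A
    by (intro density_cong AE_I2)
      (auto simp: emeasure_eq_ennreal_measure divide_ennreal[symmetric] ennreal_indicator)
  then have "integral\<^sup>L (uniform_measure M A) F = (LINT u|M. (indicator A u / measure M A) * F u)"
    using pos by (simp add: integral_density)
  then show ?thesis by simp
qed

text \<open>A factor \<open>1 - \<rho>\<close> cancels, and the remaining geometric sum has
  \<open>m\<close> terms tending to 1. With \<open>m\<close> the dimension,
  \<open>1 - \<rho> ^ m\<close> is the fraction of the unit ball's volume in the shell; this limit
  is the source of the dimension factor in the divergence theorem.\<close>

lemma power_quotient_tendsto:
  fixes \<rho> :: "nat \<Rightarrow> real"
  assumes "\<rho> \<longlonglongrightarrow> 1" "\<And>n. 0 < \<rho> n" "\<And>n. \<rho> n < 1"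
  shows "(\<lambda>n. 2 / (1 - (\<rho> n)\<^sup>2) * (1 - \<rho> n ^ m)) \<longlonglongrightarrow> real m"
proof -
  have eq: "2 / (1 - (\<rho> n)\<^sup>2) * (1 - \<rho> n ^ m) = 2 / (1 + \<rho> n) * (\<Sum>i<m. \<rho> n ^ i)" for n
  proof -
    have "1 - \<rho> n ^ m = (1 - \<rho> n) * (\<Sum>i<m. \<rho> n ^ i)"
      by (rule one_diff_power_eq)
    moreover have "1 - (\<rho> n)\<^sup>2 = (1 - \<rho> n) * (1 + \<rho> n)"
      by (simp add: power2_eq_square algebra_simps)
    ultimately show ?thesis using assms(3)[of n] by simp
  qed
  have "(\<lambda>n. 2 / (1 + \<rho> n) * (\<Sum>i<m. \<rho> n ^ i)) \<longlonglongrightarrow> 2 / (1 + 1) * (\<Sum>i<m. 1 ^ i)"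
    by (intro tendsto_intros assms) simp
  then show ?thesis unfolding eq by simp
qed

text \<open>As \<open>\<rho>\<close> tends to 1 in the cutoff identity, the cutoff tends to the
  indicator of the ball. The normalized shell integral tends to the dimension times the integral
  over the ball of the boundary values extended constantly along rays. The latter plays the role of
  the surface integral and fits the definition of \<open>uniform_sphere\<close>.\<close>

theorem integral_ball_divergence:
  fixes f :: "'a::euclidean_space \<Rightarrow> real"
  assumes g: "\<And>y. GDERIV f y :> g y" and cont: "continuous_on UNIV g"
  shows "(LINT u|lborel. indicator (ball 0 1) u * (g u \<bullet> v))
    = real DIM('a) * (LINT u|lborel. indicator (ball 0 1) u *
        (f (u /\<^sub>R norm u) * ((u /\<^sub>R norm u) \<bullet> v)))"
proof -
  let ?m = "DIM('a)"
  have [measurable]: "ball (0::'a) 1 \<in> sets borel" by auto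
  have contf: "continuous_on UNIV f" by (rule GDERIV_imp_continuous_on[OF g])
  note [measurable] = borel_measurable_continuous_onI[OF contf] borel_measurable_continuous_onI[OF cont]
  define b where "b w = f w * (w \<bullet> v)" for w
  have [measurable]: "b \<in> borel_measurable borel" unfolding b_def by measurable
  define N where "N u = u /\<^sub>R norm u" for u :: 'a
  have [measurable]: "N \<in> borel_measurable borel" unfolding N_def by measurable
  have N: "norm (N u) \<le> 1" for u by (cases "u = 0") (auto simp: N_def)
  have gb: "GDERIV b u :> f u *\<^sub>R v + (u \<bullet> v) *\<^sub>R g u" for u
    unfolding b_def by (rule GDERIV_mult[OF g GDERIV_inner_left])
  have "continuous_on UNIV (\<lambda>u. f u *\<^sub>R v + (u \<bullet> v) *\<^sub>R g u)"
    by (intro continuous_intros cont contf)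
  from C1_imp_lipschitz_on_cball[OF gb this] obtain K where K: "K-lipschitz_on (cball 0 1) b" by blast
  note K0 = lipschitz_on_nonneg[OF K]
  have "bounded (b ` cball 0 1)"
    unfolding b_def
    by (intro compact_imp_bounded compact_continuous_image continuous_intros
      continuous_on_subset[OF contf]) auto
  then obtain B where B: "B > 0" "\<And>u. u \<in> cball 0 1 \<Longrightarrow> \<bar>b u\<bar> \<le> B"
    unfolding bounded_pos real_norm_def by blast
  have "bounded ((\<lambda>u. g u \<bullet> v) ` cball 0 1)"
    by (intro compact_imp_bounded compact_continuous_image continuous_intros
      continuous_on_subset[OF cont]) auto
  then obtain C where C: "C > 0" "\<And>u. u \<in> cball 0 1 \<Longrightarrow> \<bar>g u \<bullet> v\<bar> \<le> C"
    unfolding bounded_pos real_norm_def by blast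
  \<comment> \<open>The shift by 2 keeps the radius strictly between 0 and 1 already for
    \<open>n = 0\<close>.\<close>
  define \<rho> where "\<rho> n = 1 - 1 / real (n + 2)" for n
  have \<rho>: "0 < \<rho> n" "\<rho> n < 1" for n by (auto simp: \<rho>_def)
  have \<rho>_lim: "\<rho> \<longlonglongrightarrow> 1" unfolding \<rho>_def by real_asymp
  define S where "S n = (ball 0 1 - ball 0 (\<rho> n) :: 'a set)" for n
  have [measurable]: "S n \<in> sets borel" for n unfolding S_def by measurable
  have int: "integrable lborel (\<lambda>u. indicator A u * F u)"
    if [measurable]: "F \<in> borel_measurable borel" "A \<in> sets borel"
      and "A \<subseteq> ball 0 1" "\<And>u. u \<in> A \<Longrightarrow> \<bar>F u\<bar> \<le> B'"
    for F :: "'a \<Rightarrow> real" and A B'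
  \<comment> \<open>For empty \<open>A\<close> the bound \<open>B'\<close> may be negative, hence
    the maximum with 0.\<close>
  proof (rule integrable_lborel_bounded_support[where r = 1 and K = "max B' 0"])
    show "\<bar>indicator A u * F u\<bar> \<le> max B' 0 * indicator (cball 0 1) u" for u
      using that(3,4) by (fastforce simp: indicator_def)
  qed measurable
  \<comment> \<open>The shell is a difference of two balls, so by scaling it carries the fraction
    \<open>1 - \<rho> n ^ ?m\<close> of the integral of any bounded function of the
    direction.\<close>
  have shell: "(LINT u|lborel. indicator (S n) u * F u)
      = (1 - \<rho> n ^ ?m) * (LINT u|lborel. indicator (ball 0 1) u * F u)"
    if [measurable]: "F \<in> borel_measurable borel" and "\<And>u. \<bar>F u\<bar> \<le> B'"
      and "\<And>c u. c > 0 \<Longrightarrow> F (c *\<^sub>R u) = F u" for F :: "'a \<Rightarrow> real" and n B'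
  proof -
    have "indicator (S n) u * F u = indicator (ball 0 1) u * F u - indicator (ball 0 (\<rho> n)) u * F u" for u
      using \<rho>(2)[of n] by (auto simp: S_def indicator_def)
    moreover have "integrable lborel (\<lambda>u. indicator (ball 0 1) u * F u)"
      using that(2) by (intro int) auto
    moreover have "integrable lborel (\<lambda>u. indicator (ball 0 (\<rho> n)) u * F u)"
      using that(2) \<rho>(2)[of n] by (intro int) auto
    ultimately have "(LINT u|lborel. indicator (S n) u * F u)
        = (LINT u|lborel. indicator (ball 0 1) u * F u) - (LINT u|lborel. indicator (ball 0 (\<rho> n)) u * F u)"
      by simp
    also have "(LINT u|lborel. indicator (ball 0 (\<rho> n)) u * F u)
        = \<rho> n ^ ?m * (LINT u|lborel. indicator (ball 0 1) u * F u)"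
      using that \<rho>(1) by (intro integral_ball_scale_homogeneous)
    finally show ?thesis by (simp add: left_diff_distrib)
  qed
  define J where "J = (LINT u|lborel. indicator (ball 0 1) u * b (N u))"
  define V where "V = (LINT u|lborel. indicator (ball (0::'a) 1) u * (1::real))"
  define a where "a n u = min 1 (max 0 ((1 - u \<bullet> u) / (1 - (\<rho> n)\<^sup>2)))" for n and u :: 'a
  define c where "c n = 2 / (1 - (\<rho> n)\<^sup>2)" for n
  define E where "E n = c n * (LINT u|lborel. indicator (S n) u * b u)" for n
  have pos: "1 - (\<rho> n)\<^sup>2 > 0" for n using \<rho>[of n] by (simp add: power_less_one_iff)
  then have c0: "c n > 0" for n by (simp add: c_def)
  have a01: "0 \<le> a n u" "a n u \<le> 1" for n u by (auto simp: a_def)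
  have a_out: "a n u = 0" if "norm u \<ge> 1" for n u
    using that pos[of n] by (simp add: a_def dot_square_norm divide_le_0_iff)
  have [measurable]: "a n \<in> borel_measurable borel" for n unfolding a_def by measurable
  have E_eq: "E n = (LINT u|lborel. a n u * (g u \<bullet> v))" for n
    unfolding E_def c_def S_def b_def a_def
    by (rule integral_cutoff_derivative[OF g cont \<rho>, symmetric])
  have "E \<longlonglongrightarrow> (LINT u|lborel. indicator (ball 0 1) u * (g u \<bullet> v))"
    unfolding E_eq
  proof (rule integral_dominated_convergence)
    show "integrable lborel (\<lambda>u::'a. C * indicator (cball 0 1) u)"
      using emeasure_lborel_cball_finite[of "0::'a" 1] by auto
    show "AE u in lborel. norm (a n u * (g u \<bullet> v)) \<le> C * indicator (cball 0 1) u" for n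
    proof (rule AE_I2)
      fix u :: 'a
      show "norm (a n u * (g u \<bullet> v)) \<le> C * indicator (cball 0 1) u"
      proof (cases "norm u \<le> 1")
        case True
        then have "\<bar>a n u\<bar> * \<bar>g u \<bullet> v\<bar> \<le> 1 * C"
          using a01 C by (intro mult_mono) auto
        then show ?thesis using True by (simp add: abs_mult)
      qed (use a_out in auto)
    qed
    have "(\<lambda>n. a n u) \<longlonglongrightarrow> indicator (ball 0 1) u" for u
    proof (cases "norm u < 1")
      case True
      have lt: "(norm u)\<^sup>2 < 1" using True by (simp add: power_less_one_iff)
      have "(\<lambda>n. (\<rho> n)\<^sup>2) \<longlonglongrightarrow> 1\<^sup>2" by (intro tendsto_intros \<rho>_lim)
      then have "eventually (\<lambda>n. (\<rho> n)\<^sup>2 > (norm u)\<^sup>2) sequentially"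
        using lt by (intro order_tendstoD) auto
      then have "eventually (\<lambda>n. a n u = 1) sequentially"
      proof eventually_elim
        case (elim n)
        then show ?case using pos[of n] by (simp add: a_def dot_square_norm)
      qed
      then show ?thesis using True by (simp add: tendsto_eventually)
    next
      case False
      then show ?thesis using a_out by simp
    qed
    then show "AE u in lborel. (\<lambda>n. a n u * (g u \<bullet> v)) \<longlonglongrightarrow> indicator (ball 0 1) u * (g u \<bullet> v)"
      by (intro AE_I2 tendsto_intros)
  qed auto
  moreover have "E \<longlonglongrightarrow> real ?m * J"
  proof -
    have cJ: "(\<lambda>n. c n * (1 - \<rho> n ^ ?m)) \<longlonglongrightarrow> real ?m"
      unfolding c_def by (rule power_quotient_tendsto[OF \<rho>_lim \<rho>])
    \<comment> \<open>A point of the shell is within \<open>1 - \<rho> n\<close> of its direction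
      \<open>N u\<close>. Replacing \<open>b u\<close> by \<open>b (N u)\<close> therefore costs at
      most \<open>K * (1 - \<rho> n)\<close> times the normalized shell volume. That volume
      converges, so the error vanishes in the limit.\<close>
    have close: "norm (E n - c n * (1 - \<rho> n ^ ?m) * J)
        \<le> K * (1 - \<rho> n) * (c n * (1 - \<rho> n ^ ?m) * V)" for n
    proof -
      have J: "(1 - \<rho> n ^ ?m) * J = (LINT u|lborel. indicator (S n) u * b (N u))"
        unfolding J_def
        by (rule shell[symmetric, where B' = B])
          (use B N in \<open>auto simp: N_def mult.commute[of "norm _"] field_simps\<close>)
      have V: "(1 - \<rho> n ^ ?m) * V = (LINT u|lborel. indicator (S n) u * 1)"
        unfolding V_def by (rule shell[symmetric, where B' = 1]) auto
      have i1: "integrable lborel (\<lambda>u. indicator (S n) u * b u)"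
        using B by (intro int[where B' = B]) (auto simp: S_def)
      have i2: "integrable lborel (\<lambda>u. indicator (S n) u * b (N u))"
        using B N by (intro int[where B' = B]) (auto simp: S_def)
      have i3: "integrable lborel (\<lambda>u. indicator (S n) u * (1::real))"
        by (intro int[where B' = 1]) (auto simp: S_def)
      have "\<bar>(LINT u|lborel. indicator (S n) u * b u) - (LINT u|lborel. indicator (S n) u * b (N u))\<bar>
          = \<bar>LINT u|lborel. indicator (S n) u * b u - indicator (S n) u * b (N u)\<bar>"
        using i1 i2 by simp
      also have "\<dots> \<le> (LINT u|lborel. \<bar>indicator (S n) u * b u - indicator (S n) u * b (N u)\<bar>)"
        by (rule integral_abs_bound)
      also have "\<dots> \<le> (LINT u|lborel. K * (1 - \<rho> n) * (indicator (S n) u * 1))"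
      proof (rule integral_mono)
        fix u :: 'a
        show "\<bar>indicator (S n) u * b u - indicator (S n) u * b (N u)\<bar>
            \<le> K * (1 - \<rho> n) * (indicator (S n) u * 1)"
        proof (cases "u \<in> S n")
          case True
          then have u: "norm u < 1" "\<rho> n \<le> norm u" by (auto simp: S_def)
          have "u - N u = (1 - 1 / norm u) *\<^sub>R u"
            by (simp add: N_def scaleR_left_diff_distrib inverse_eq_divide)
          then have "norm (u - N u) = \<bar>1 - 1 / norm u\<bar> * norm u" by simp
          also have "\<dots> = \<bar>norm u - 1\<bar>"
          proof -
            have "norm u > 0" using u \<rho>(1)[of n] by linarith
            then have "\<bar>1 - 1 / norm u\<bar> * norm u = \<bar>(1 - 1 / norm u) * norm u\<bar>"
              by (simp add: abs_mult)
            also have "(1 - 1 / norm u) * norm u = norm u - 1"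
              using \<open>norm u > 0\<close> by (simp add: left_diff_distrib)
            finally show ?thesis .
          qed
          finally have "norm (u - N u) \<le> 1 - \<rho> n" using u by simp
          then have "K * dist u (N u) \<le> K * (1 - \<rho> n)"
            using K0 by (intro mult_left_mono) (auto simp: dist_norm)
          moreover have "\<bar>b u - b (N u)\<bar> \<le> K * dist u (N u)"
            using lipschitz_onD[OF K, of u "N u"] u N[of u] by (simp add: dist_real_def)
          ultimately show ?thesis using True by simp
        qed simp
      qed (use i1 i2 i3 in auto)
      finally have "\<bar>(LINT u|lborel. indicator (S n) u * b u) - (1 - \<rho> n ^ ?m) * J\<bar>
          \<le> K * (1 - \<rho> n) * ((1 - \<rho> n ^ ?m) * V)"
        using i3 by (simp add: J V)
      then have "c n * \<bar>(LINT u|lborel. indicator (S n) u * b u) - (1 - \<rho> n ^ ?m) * J\<bar>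
          \<le> c n * (K * (1 - \<rho> n) * ((1 - \<rho> n ^ ?m) * V))"
        using c0[of n] by (intro mult_left_mono) auto
      moreover have "norm (E n - c n * (1 - \<rho> n ^ ?m) * J)
          = c n * \<bar>(LINT u|lborel. indicator (S n) u * b u) - (1 - \<rho> n ^ ?m) * J\<bar>"
        using c0[of n] unfolding E_def
        by (simp add: abs_mult mult.assoc right_diff_distrib[symmetric])
      ultimately show ?thesis by (simp add: mult_ac)
    qed
    have "(\<lambda>n. K * (1 - \<rho> n) * (c n * (1 - \<rho> n ^ ?m) * V)) \<longlonglongrightarrow> K * (1 - 1) * (real ?m * V)"
      by (intro tendsto_intros cJ \<rho>_lim)
    then have "(\<lambda>n. E n - c n * (1 - \<rho> n ^ ?m) * J) \<longlonglongrightarrow> 0"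
      by (intro Lim_null_comparison[OF always_eventually[OF allI, OF close]]) simp
    moreover have "(\<lambda>n. c n * (1 - \<rho> n ^ ?m) * J) \<longlonglongrightarrow> real ?m * J"
      by (intro tendsto_intros cJ)
    ultimately have "(\<lambda>n. (E n - c n * (1 - \<rho> n ^ ?m) * J) + c n * (1 - \<rho> n ^ ?m) * J)
        \<longlonglongrightarrow> 0 + real ?m * J"
      by (rule tendsto_add)
    then show ?thesis by simp
  qed
  ultimately have "(LINT u|lborel. indicator (ball 0 1) u * (g u \<bullet> v)) = real ?m * J"
    by (rule LIMSEQ_unique)
  then show ?thesis by (simp add: J_def b_def N_def)
qed

section \<open>The divergence identity and moments for a uniform direction\<close>

text \<open>Dividing by the volume of the ball turns both Lebesgue integrals into means, and
  normalization pushes the uniform law of the ball to that of the sphere.\<close>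

corollary integral_uniform_sphere_divergence:
  fixes f :: "'a::euclidean_space \<Rightarrow> real"
  assumes g: "\<And>y. GDERIV f y :> g y" and cont: "continuous_on UNIV g"
  shows "(LINT u|uniform_measure lborel (ball 0 1). g u \<bullet> v)
    = real DIM('a) * (LINT s|uniform_sphere. f s * (s \<bullet> v))"
proof -
  have contf: "continuous_on UNIV f" by (rule GDERIV_imp_continuous_on[OF g])
  note [measurable] = borel_measurable_continuous_onI[OF contf] borel_measurable_continuous_onI[OF cont]
  have "emeasure lborel (ball 0 1 :: 'a set) \<noteq> 0"
    using content_ball_pos[of 1 "0::'a"] by (auto simp: measure_def)
  moreover have "emeasure lborel (ball 0 1 :: 'a set) \<noteq> \<infinity>"
    using emeasure_lborel_ball_finite[of "0::'a" 1] by auto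
  ultimately have *: "integral\<^sup>L (uniform_measure lborel (ball 0 1)) F
      = (LINT u|lborel. indicator (ball 0 1) u * F u) / measure lborel (ball (0::'a) 1)"
    if "F \<in> borel_measurable borel" for F :: "'a \<Rightarrow> real"
    using that by (intro integral_uniform_measure) auto
  have "(LINT s|uniform_sphere. f s * (s \<bullet> v))
      = (LINT u|uniform_measure lborel (ball 0 1). f (u /\<^sub>R norm u) * ((u /\<^sub>R norm u) \<bullet> v))"
    unfolding uniform_sphere_def by (rule integral_distr) auto
  then show ?thesis
    using integral_ball_divergence[OF g cont, of v] by (simp add: *)
qed

text \<open>This is the divergence identity for a constant function. It removes from the mean of the
  estimator every factor that does not depend on the direction.\<close>

lemma integral_uniform_sphere_inner:
  "(LINT s|uniform_sphere. s \<bullet> v) = (0::real)" for v :: "'a::euclidean_space"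
  using integral_uniform_sphere_divergence[of "\<lambda>_. 1" "\<lambda>_. 0" v]
  by (simp add: GDERIV_const)

text \<open>The divergence identity for the linear function with gradient \<open>v\<close>. The
  division by the dimension later reduces a factor \<open>m^2\<close> in the second moment to
  \<open>m\<close>.\<close>

lemma integral_uniform_sphere_inner_square:
  "(LINT s|uniform_sphere. (s \<bullet> v)\<^sup>2) = (norm v)\<^sup>2 / real DIM('a)" for v :: "'a::euclidean_space"
proof -
  interpret prob_space "uniform_measure lborel (ball 0 1 :: 'a set)"
    using content_ball_pos[of 1 "0::'a"] emeasure_lborel_ball_finite[of "0::'a" 1]
    by (intro prob_space_uniform_measure) (auto simp: measure_def)
  show ?thesis
    using integral_uniform_sphere_divergence[of "\<lambda>u. u \<bullet> v" "\<lambda>_. v" v] prob_space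
    by (simp add: GDERIV_inner_left power2_eq_square dot_square_norm field_simps)
qed

section \<open>One step of the method\<close>

text \<open>Restriction to the line through \<open>z\<close> and \<open>y\<close> reduces this to
  the tangent inequality in one variable.\<close>

lemma convex_gradient_above_tangent:
  fixes f :: "'a::real_inner \<Rightarrow> real"
  assumes conv: "convex_on UNIV f" and g: "\<And>y. GDERIV f y :> g y"
  shows "f z + g z \<bullet> (y - z) \<le> f y"
proof -
  have "convex_on UNIV (\<lambda>t. f (z + t *\<^sub>R (y - z)))"
  proof (rule convex_onI)
    fix t a b :: real assume t: "0 < t" "t < 1"
    have "z + ((1 - t) *\<^sub>R a + t *\<^sub>R b) *\<^sub>R (y - z)
        = (1 - t) *\<^sub>R (z + a *\<^sub>R (y - z)) + t *\<^sub>R (z + b *\<^sub>R (y - z))"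
      by (simp add: algebra_simps)
    then show "f (z + ((1 - t) *\<^sub>R a + t *\<^sub>R b) *\<^sub>R (y - z))
        \<le> (1 - t) * f (z + a *\<^sub>R (y - z)) + t * f (z + b *\<^sub>R (y - z))"
      using convex_onD[OF conv, of t] t by simp
  qed simp
  from convex_on_imp_above_tangent[OF this, of 0 1] gderiv_along_line[of f g z "y - z" 0, OF g]
  show ?thesis by fastforce
qed

text \<open>The dimension is a real parameter \<open>m\<close>, fixed by \<open>m_eq\<close>, so
  that the algebra treats it as a single symbol.\<close>

locale inexact_oracle =
  fixes f \<delta>err :: "real ^ 'm \<Rightarrow> real" and gradf :: "real ^ 'm \<Rightarrow> real ^ 'm"
    and xstar :: "real ^ 'm" and L \<delta> \<mu> m :: real
  assumes m_eq: "m = real CARD('m)"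
    and convex: "convex_on UNIV f"
    and gradient: "\<And>y. GDERIV f y :> gradf y"
    and L_pos: "L > 0"
    and lipschitz_gradient: "L-lipschitz_on UNIV gradf"
    and minimum: "\<And>y. f xstar \<le> f y"
    and \<delta>_nonneg: "\<delta> \<ge> 0"
    and \<delta>err_measurable [measurable]: "\<delta>err \<in> borel_measurable borel"
    and \<delta>err_bound: "\<And>y. \<bar>\<delta>err y\<bar> \<le> \<delta>"
    and \<mu>_pos: "\<mu> > 0"
begin

abbreviation "\<sigma> \<equiv> (uniform_sphere :: (real ^ 'm) measure)"

abbreviation "G \<equiv> zo_gradient \<mu> (\<lambda>y. f y + \<delta>err y)"

sublocale \<sigma>: prob_space \<sigma>
  by (rule prob_space_uniform_sphere)

lemma sets_sphere [measurable_cong, simp]: "sets \<sigma> = sets borel"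
  by (simp add: uniform_sphere_def)

lemma m_pos [simp]: "m > 0"
  by (simp add: m_eq)

lemma m_nonneg [simp]: "m \<ge> 0" and m_nonzero [simp]: "m \<noteq> 0"
  by (simp_all add: m_eq)

lemma G_eq: "G x s = (m / \<mu> * (f (x + \<mu> *\<^sub>R s) + \<delta>err (x + \<mu> *\<^sub>R s) - (f x + \<delta>err x))) *\<^sub>R s"
  by (simp add: zo_gradient_def m_eq)

lemma quadratic_bound: "\<bar>f x - f y - gradf y \<bullet> (x - y)\<bar> \<le> L / 2 * (norm (x - y))\<^sup>2"
  by (rule lipschitz_gradient_imp_quadratic_bound[OF gradient lipschitz_gradient])

lemma continuous_gradf: "continuous_on UNIV gradf"
  by (rule lipschitz_on_continuous_on[OF lipschitz_gradient])

lemma continuous_f: "continuous_on UNIV f"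
  by (rule GDERIV_imp_continuous_on[OF gradient])

lemma measurable_f [measurable]: "f \<in> borel_measurable borel"
  by (rule borel_measurable_continuous_onI[OF continuous_f])

lemma measurable_gradf [measurable]: "gradf \<in> borel_measurable borel"
  by (rule borel_measurable_continuous_onI[OF continuous_gradf])

lemma measurable_G [measurable]: "(\<lambda>(x, s). G x s) \<in> borel_measurable (borel \<Otimes>\<^sub>M borel)"
  unfolding zo_gradient_def by measurable

lemma gradf_xstar: "gradf xstar = 0"
  using gradient[of xstar] minimum unfolding gderiv_def
  by (metis differential_zero_maxmin inner_eq_zero_iff open_UNIV UNIV_I)

lemma f_upper: "f y \<le> f xstar + L / 2 * (norm (y - xstar))\<^sup>2"
proof -
  have "\<bar>f y - f xstar\<bar> \<le> L / 2 * (norm (y - xstar))\<^sup>2"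
    using quadratic_bound[of y xstar] by (simp add: gradf_xstar)
  then show ?thesis by linarith
qed

text \<open>A gradient step of length \<open>1 / L\<close> from \<open>y\<close> lowers
  \<open>f\<close> by at least \<open>(norm (gradf y))^2 / (2 * L)\<close>, yet cannot go below the
  minimum.\<close>

lemma norm_gradf_square: "(norm (gradf y))\<^sup>2 \<le> 2 * L * (f y - f xstar)"
proof -
  define z where "z = y - (1 / L) *\<^sub>R gradf y"
  have "f xstar \<le> f z" by (rule minimum)
  also have "\<dots> \<le> f y + gradf y \<bullet> (z - y) + L / 2 * (norm (z - y))\<^sup>2"
    using quadratic_bound[of z y] by linarith
  also have "gradf y \<bullet> (z - y) = - (norm (gradf y))\<^sup>2 / L"
    by (simp add: z_def power2_norm_eq_inner)
  also have "L / 2 * (norm (z - y))\<^sup>2 = (norm (gradf y))\<^sup>2 / (2 * L)"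
    using L_pos by (simp add: z_def power2_eq_square field_simps)
  finally show ?thesis using L_pos by (simp add: field_simps)
qed

text \<open>Smoothness bounds \<open>f x\<close> from above and convexity bounds \<open>f y\<close>
  from below, both by expansion at \<open>z\<close>. In the difference \<open>f z\<close>
  cancels.\<close>

lemma gradf_inner_lower:
  "gradf z \<bullet> (x - y) \<ge> f x - f y - L / 2 * (norm (x - z))\<^sup>2"
  using quadratic_bound[of x z] convex_gradient_above_tangent[OF convex gradient, of z y]
  unfolding inner_diff_right by linarith

section \<open>Bias and second moment of the estimator\<close>

lemma integrable_sphere:
  fixes F :: "real ^ 'm \<Rightarrow> real"
  assumes "F \<in> borel_measurable borel" and "\<And>s. norm s = 1 \<Longrightarrow> \<bar>F s\<bar> \<le> B"
  shows "integrable \<sigma> F"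
proof (rule \<sigma>.integrable_const_bound)
  show "AE s in \<sigma>. norm (F s) \<le> B"
    using AE_uniform_sphere by eventually_elim (simp add: assms)
  show "F \<in> borel_measurable \<sigma>" using assms(1) by simp
qed

lemma integrable_sphere_continuous:
  fixes F :: "real ^ 'm \<Rightarrow> real"
  assumes "continuous_on UNIV F"
  shows "integrable \<sigma> F"
proof -
  have "bounded (F ` cball 0 1)"
    by (intro compact_imp_bounded compact_continuous_image continuous_on_subset[OF assms]) auto
  then obtain B where "B > 0" "\<And>u. u \<in> cball 0 1 \<Longrightarrow> \<bar>F u\<bar> \<le> B"
    unfolding bounded_pos real_norm_def by blast
  then show ?thesis
    by (intro integrable_sphere[of F B] borel_measurable_continuous_onI[OF assms]) auto
qed

text \<open>The divergence identity for the map from \<open>u\<close> to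
  \<open>f (x + \<mu> *\<^sub>R u)\<close> replaces the left side by a mean of gradients at points
  within \<mu> of \<open>x\<close>, to which \<open>gradf_inner_lower\<close> applies
  pointwise.\<close>

lemma integral_oracle_inner_lower:
  "m / \<mu> * (LINT s|\<sigma>. f (x + \<mu> *\<^sub>R s) * (s \<bullet> (x - y))) \<ge> f x - f y - L * \<mu>\<^sup>2 / 2"
proof -
  let ?U = "uniform_measure lborel (ball 0 1 :: (real ^ 'm) set)"
  interpret U: prob_space ?U
    using content_ball_pos[of 1 "0::real ^ 'm"] emeasure_lborel_ball_finite[of "0::real ^ 'm" 1]
    by (intro prob_space_uniform_measure) (auto simp: measure_def)
  have AE_U: "AE u in ?U. norm u < 1"
    by (rule AE_uniform_measureI) auto
  have deriv: "GDERIV (\<lambda>u. f (x + \<mu> *\<^sub>R u)) u :> \<mu> *\<^sub>R gradf (x + \<mu> *\<^sub>R u)" for u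
  proof -
    have 1: "((\<lambda>u. x + \<mu> *\<^sub>R u) has_derivative (\<lambda>h. \<mu> *\<^sub>R h)) (at u)"
      by (auto intro!: derivative_eq_intros)
    have 2: "(f has_derivative (\<lambda>h. h \<bullet> gradf (x + \<mu> *\<^sub>R u))) (at (x + \<mu> *\<^sub>R u))"
      using gradient by (simp add: gderiv_def)
    show ?thesis
      using has_derivative_compose[OF 1 2] by (simp add: gderiv_def)
  qed
  have cont: "continuous_on UNIV (\<lambda>u. \<mu> *\<^sub>R gradf (x + \<mu> *\<^sub>R u))"
    by (intro continuous_intros continuous_on_compose2[OF continuous_gradf]) auto
  have "f x - f y - L * \<mu>\<^sup>2 / 2 = (LINT u|?U. f x - f y - L * \<mu>\<^sup>2 / 2)"
    using U.prob_space by simp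
  also have "\<dots> \<le> (LINT u|?U. gradf (x + \<mu> *\<^sub>R u) \<bullet> (x - y))"
  proof (rule integral_mono_AE)
    have "bounded ((\<lambda>u. gradf (x + \<mu> *\<^sub>R u) \<bullet> (x - y)) ` cball 0 1)"
      by (intro compact_imp_bounded compact_continuous_image continuous_intros
        continuous_on_compose2[OF continuous_gradf]) auto
    then obtain B where B: "B > 0"
      "\<And>u. u \<in> cball 0 1 \<Longrightarrow> \<bar>gradf (x + \<mu> *\<^sub>R u) \<bullet> (x - y)\<bar> \<le> B"
      unfolding bounded_pos real_norm_def by blast
    show "integrable ?U (\<lambda>u. gradf (x + \<mu> *\<^sub>R u) \<bullet> (x - y))"
    proof (rule U.integrable_const_bound)
      show "AE u in ?U. norm (gradf (x + \<mu> *\<^sub>R u) \<bullet> (x - y)) \<le> B"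
        using AE_U by eventually_elim (simp add: B)
    qed simp
    show "AE u in ?U. f x - f y - L * \<mu>\<^sup>2 / 2 \<le> gradf (x + \<mu> *\<^sub>R u) \<bullet> (x - y)"
      using AE_U
    proof eventually_elim
      case (elim u)
      have "L / 2 * (norm (x - (x + \<mu> *\<^sub>R u)))\<^sup>2 = L * \<mu>\<^sup>2 / 2 * (norm u)\<^sup>2"
        by (simp add: power_mult_distrib)
      also have "\<dots> \<le> L * \<mu>\<^sup>2 / 2 * 1"
        using elim L_pos by (intro mult_left_mono) (auto simp: abs_square_le_1)
      finally show ?case using gradf_inner_lower[of x y "x + \<mu> *\<^sub>R u"] by linarith
    qed
  qed simp
  also have "\<dots> = (LINT u|?U. (\<mu> *\<^sub>R gradf (x + \<mu> *\<^sub>R u)) \<bullet> (x - y)) / \<mu>"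
    using \<mu>_pos by simp
  also have "\<dots> = m / \<mu> * (LINT s|\<sigma>. f (x + \<mu> *\<^sub>R s) * (s \<bullet> (x - y)))"
    using integral_uniform_sphere_divergence[OF deriv cont, of "x - y"] by (simp add: m_eq)
  finally show ?thesis .
qed

lemma integral_G_inner_lower:
  "(LINT s|\<sigma>. G x s \<bullet> (x - y)) \<ge> f x - f y - L * \<mu>\<^sup>2 / 2 - m * \<delta> * norm (x - y) / \<mu>"
proof -
  let ?v = "x - y"
  have inner_le: "\<bar>s \<bullet> ?v\<bar> \<le> norm ?v" if "norm s = 1" for s
    using Cauchy_Schwarz_ineq2[of s ?v] that by simp
  have noise_le: "\<bar>\<delta>err (x + \<mu> *\<^sub>R s) * (s \<bullet> ?v)\<bar> \<le> \<delta> * norm ?v" if "norm s = 1" for s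
    unfolding abs_mult using \<delta>err_bound \<delta>_nonneg inner_le[OF that] by (intro mult_mono) auto
  have i1: "integrable \<sigma> (\<lambda>s. f (x + \<mu> *\<^sub>R s) * (s \<bullet> ?v))"
    by (intro integrable_sphere_continuous continuous_intros continuous_on_compose2[OF continuous_f]) auto
  have i2: "integrable \<sigma> (\<lambda>s. \<delta>err (x + \<mu> *\<^sub>R s) * (s \<bullet> ?v))"
    by (rule integrable_sphere[OF _ noise_le]) auto
  have i3: "integrable \<sigma> (\<lambda>s. s \<bullet> ?v)"
    by (intro integrable_sphere_continuous continuous_intros)
  have G: "G x s \<bullet> w = m / \<mu> * (f (x + \<mu> *\<^sub>R s) * (s \<bullet> w)
      + \<delta>err (x + \<mu> *\<^sub>R s) * (s \<bullet> w) - (f x + \<delta>err x) * (s \<bullet> w))" for s w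
    unfolding G_eq inner_scaleR_left by (simp add: algebra_simps)
  have "(LINT s|\<sigma>. G x s \<bullet> ?v) = (LINT s|\<sigma>. m / \<mu> * (f (x + \<mu> *\<^sub>R s) * (s \<bullet> ?v)
      + \<delta>err (x + \<mu> *\<^sub>R s) * (s \<bullet> ?v) - (f x + \<delta>err x) * (s \<bullet> ?v)))"
    by (simp only: G)
  \<comment> \<open>The oracle value at \<open>x\<close> is constant in \<open>s\<close>, so its
    term vanishes by centredness; only the error at the shifted point remains.\<close>
  also have "\<dots> = m / \<mu> * (LINT s|\<sigma>. f (x + \<mu> *\<^sub>R s) * (s \<bullet> ?v))
      + m / \<mu> * (LINT s|\<sigma>. \<delta>err (x + \<mu> *\<^sub>R s) * (s \<bullet> ?v))"
    using i1 i2 i3 by (simp add: integral_uniform_sphere_inner add_divide_distrib distrib_left)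
  also have "\<dots> \<ge> (f x - f y - L * \<mu>\<^sup>2 / 2) + m / \<mu> * (- (\<delta> * norm ?v))"
  proof (intro add_mono mult_left_mono)
    have "\<bar>LINT s|\<sigma>. \<delta>err (x + \<mu> *\<^sub>R s) * (s \<bullet> ?v)\<bar> \<le> (LINT s|\<sigma>. \<bar>\<delta>err (x + \<mu> *\<^sub>R s) * (s \<bullet> ?v)\<bar>)"
      by (rule integral_abs_bound)
    also have "\<dots> \<le> (LINT s|\<sigma>. \<delta> * norm ?v)"
      using AE_uniform_sphere
      by (intro integral_mono_AE) (auto intro!: integrable_abs i2 elim!: eventually_mono dest: noise_le)
    also have "\<dots> = \<delta> * norm ?v" using \<sigma>.prob_space by simp
    finally show "- (\<delta> * norm ?v) \<le> (LINT s|\<sigma>. \<delta>err (x + \<mu> *\<^sub>R s) * (s \<bullet> ?v))" by linarith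
  qed (use \<mu>_pos integral_oracle_inner_lower in auto)
  finally show ?thesis by (simp add: mult_ac)
qed

text \<open>The difference of oracle values is a linear part \<open>\<mu> * a\<close>, a Taylor
  remainder \<open>e\<close> of size at most \<open>L * \<mu>\<^sup>2 / 2\<close>, and a noise
  difference \<open>d\<close> of size at most \<open>2 * \<delta>\<close>. Splitting off
  \<open>d\<close> first and then \<open>e\<close>, each time by
  \<open>(p + q)^2 \<le> 2 * p^2 + 2 * q^2\<close>, gives the weights 4, 4 and 2.\<close>

lemma norm_G_square_le:
  assumes "norm s = 1"
  shows "(norm (G x s))\<^sup>2 \<le> 4 * m\<^sup>2 * (s \<bullet> gradf x)\<^sup>2 + (m\<^sup>2 * L\<^sup>2 * \<mu>\<^sup>2 + 8 * m\<^sup>2 * \<delta>\<^sup>2 / \<mu>\<^sup>2)"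
proof -
  define a where "a = s \<bullet> gradf x"
  define e where "e = f (x + \<mu> *\<^sub>R s) - f x - \<mu> * a"
  define d where "d = \<delta>err (x + \<mu> *\<^sub>R s) - \<delta>err x"
  have "\<bar>e\<bar> \<le> L * \<mu>\<^sup>2 / 2"
    using quadratic_bound[of "x + \<mu> *\<^sub>R s" x] assms
    by (simp add: e_def a_def inner_commute power_mult_distrib)
  then have e: "e\<^sup>2 \<le> (L * \<mu>\<^sup>2 / 2)\<^sup>2" by (rule abs_le_square_iff[THEN iffD1, OF order_trans]) simp
  have "\<bar>d\<bar> \<le> 2 * \<delta>"
    using \<delta>err_bound[of "x + \<mu> *\<^sub>R s"] \<delta>err_bound[of x] by (simp add: d_def)
  then have d: "d\<^sup>2 \<le> (2 * \<delta>)\<^sup>2" by (rule abs_le_square_iff[THEN iffD1, OF order_trans]) simp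
  have "(\<mu> * a + e + d)\<^sup>2 \<le> 2 * (\<mu> * a + e)\<^sup>2 + 2 * d\<^sup>2"
    using zero_le_power2[of "\<mu> * a + e - d"] by (simp add: power2_eq_square algebra_simps)
  moreover have "(\<mu> * a + e)\<^sup>2 \<le> 2 * (\<mu> * a)\<^sup>2 + 2 * e\<^sup>2"
    using zero_le_power2[of "\<mu> * a - e"] by (simp add: power2_eq_square algebra_simps)
  ultimately have sq: "(\<mu> * a + e + d)\<^sup>2 \<le> 4 * (\<mu> * a)\<^sup>2 + 4 * (L * \<mu>\<^sup>2 / 2)\<^sup>2 + 2 * (2 * \<delta>)\<^sup>2"
    using e d by linarith
  have "G x s = (m / \<mu> * (\<mu> * a + e + d)) *\<^sub>R s"
    by (simp add: G_eq a_def e_def d_def)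
  then have "(norm (G x s))\<^sup>2 = (m / \<mu>)\<^sup>2 * (\<mu> * a + e + d)\<^sup>2"
    using assms by (simp add: power_mult_distrib power_divide)
  also have "\<dots> \<le> (m / \<mu>)\<^sup>2 * (4 * (\<mu> * a)\<^sup>2 + 4 * (L * \<mu>\<^sup>2 / 2)\<^sup>2 + 2 * (2 * \<delta>)\<^sup>2)"
    by (intro mult_left_mono sq) auto
  also have "\<dots> = 4 * m\<^sup>2 * a\<^sup>2 + (m\<^sup>2 * L\<^sup>2 * \<mu>\<^sup>2 + 8 * m\<^sup>2 * \<delta>\<^sup>2 / \<mu>\<^sup>2)"
    using \<mu>_pos by (simp add: field_simps power2_eq_square)
  finally show ?thesis by (simp add: a_def)
qed

lemma integrable_norm_G_square: "integrable \<sigma> (\<lambda>s. (norm (G x s))\<^sup>2)"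
proof (rule integrable_sphere)
  fix s :: "real ^ 'm" assume s: "norm s = 1"
  have "(s \<bullet> gradf x)\<^sup>2 \<le> (norm (gradf x))\<^sup>2"
    using Cauchy_Schwarz_ineq2[of s "gradf x"] s by (simp add: abs_le_square_iff[symmetric])
  then have "4 * m\<^sup>2 * (s \<bullet> gradf x)\<^sup>2 \<le> 4 * m\<^sup>2 * (norm (gradf x))\<^sup>2"
    by (intro mult_left_mono) auto
  with norm_G_square_le[OF s, of x]
  show "\<bar>(norm (G x s))\<^sup>2\<bar> \<le> 4 * m\<^sup>2 * (norm (gradf x))\<^sup>2
      + (m\<^sup>2 * L\<^sup>2 * \<mu>\<^sup>2 + 8 * m\<^sup>2 * \<delta>\<^sup>2 / \<mu>\<^sup>2)"
    unfolding abs_of_nonneg[OF zero_le_power2] by linarith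
qed measurable

lemma integrable_G_inner: "integrable \<sigma> (\<lambda>s. G x s \<bullet> v)"
proof (rule Bochner_Integration.integrable_bound)
  show "integrable \<sigma> (\<lambda>s. (norm (G x s))\<^sup>2 + (norm v)\<^sup>2)"
    by (intro Bochner_Integration.integrable_add integrable_norm_G_square) simp
  have "\<bar>G x s \<bullet> v\<bar> \<le> (norm (G x s))\<^sup>2 + (norm v)\<^sup>2" for s
  proof -
    have "\<bar>G x s \<bullet> v\<bar> \<le> norm (G x s) * norm v" by (rule Cauchy_Schwarz_ineq2)
    moreover have "2 * (norm (G x s) * norm v) \<le> (norm (G x s))\<^sup>2 + (norm v)\<^sup>2"
      using sum_squares_bound[of "norm (G x s)" "norm v"] by simp
    moreover have "0 \<le> norm (G x s) * norm v" by simp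
    ultimately show ?thesis by linarith
  qed
  then show "AE s in \<sigma>. norm (G x s \<bullet> v) \<le> norm ((norm (G x s))\<^sup>2 + (norm v)\<^sup>2)"
    by simp
qed measurable

text \<open>Averaging over the direction saves one factor \<open>m\<close> in the gradient term, and
  the squared gradient norm is then bounded by the optimality gap.\<close>

lemma integral_norm_G_square_le:
  "(LINT s|\<sigma>. (norm (G x s))\<^sup>2)
    \<le> 8 * m * L * (f x - f xstar) + m\<^sup>2 * L\<^sup>2 * \<mu>\<^sup>2 + 8 * m\<^sup>2 * \<delta>\<^sup>2 / \<mu>\<^sup>2"
proof -
  have i: "integrable \<sigma> (\<lambda>s. (s \<bullet> gradf x)\<^sup>2)"
    by (intro integrable_sphere_continuous continuous_intros)
  have "(LINT s|\<sigma>. (norm (G x s))\<^sup>2)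
      \<le> (LINT s|\<sigma>. 4 * m\<^sup>2 * (s \<bullet> gradf x)\<^sup>2 + (m\<^sup>2 * L\<^sup>2 * \<mu>\<^sup>2 + 8 * m\<^sup>2 * \<delta>\<^sup>2 / \<mu>\<^sup>2))"
    using AE_uniform_sphere i
    by (intro integral_mono_AE integrable_norm_G_square)
      (auto elim!: eventually_mono dest: norm_G_square_le)
  also have "\<dots> = 4 * m\<^sup>2 * ((norm (gradf x))\<^sup>2 / m) + (m\<^sup>2 * L\<^sup>2 * \<mu>\<^sup>2 + 8 * m\<^sup>2 * \<delta>\<^sup>2 / \<mu>\<^sup>2)"
    using i \<sigma>.prob_space by (simp add: integral_uniform_sphere_inner_square m_eq)
  also have "4 * m\<^sup>2 * ((norm (gradf x))\<^sup>2 / m) = 4 * m * (norm (gradf x))\<^sup>2"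
    by (simp add: power2_eq_square)
  also have "\<dots> \<le> 4 * m * (2 * L * (f x - f xstar))"
    by (intro mult_left_mono norm_gradf_square) simp
  finally show ?thesis by simp
qed

section \<open>Expected progress of one step before projection\<close>

lemma expected_gradient_step:
  assumes h: "h = 1 / (8 * m * L)" and x: "norm (x - xstar) \<le> 3 * R"
  shows "integrable \<sigma> (\<lambda>s. (norm (x - h *\<^sub>R G x s - xstar))\<^sup>2)"
    and "(LINT s|\<sigma>. (norm (x - h *\<^sub>R G x s - xstar))\<^sup>2)
      \<le> (norm (x - xstar))\<^sup>2 - h * (f x - f xstar)
        + h * (\<mu>\<^sup>2 * L * (m + 8) / 8 + 8 * \<delta> * m * R / \<mu> + \<delta>\<^sup>2 * m / (L * \<mu>\<^sup>2))"
proof -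
  let ?v = "x - xstar"
  have h0: "h > 0" and h1: "h * (8 * m * L) = 1" using h L_pos by auto
  have expand: "(norm (x - h *\<^sub>R G x s - xstar))\<^sup>2
      = (norm ?v)\<^sup>2 - 2 * h * (G x s \<bullet> ?v) + h\<^sup>2 * (norm (G x s))\<^sup>2" for s
  proof -
    have "x - h *\<^sub>R G x s - xstar = ?v - h *\<^sub>R G x s" by simp
    then show ?thesis
      by (simp only: power2_norm_eq_inner) (simp add: inner_diff inner_commute power2_eq_square algebra_simps)
  qed
  show "integrable \<sigma> (\<lambda>s. (norm (x - h *\<^sub>R G x s - xstar))\<^sup>2)"
    unfolding expand using integrable_G_inner integrable_norm_G_square by simp
  define A where "A = m\<^sup>2 * L\<^sup>2 * \<mu>\<^sup>2 + 8 * m\<^sup>2 * \<delta>\<^sup>2 / \<mu>\<^sup>2"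
  define \<Delta> where "\<Delta> = f x - f xstar"
  have bias: "m * \<delta> * norm ?v / \<mu> \<le> 3 * (\<delta> * m * R / \<mu>)"
  proof -
    have "(m * \<delta> / \<mu>) * norm ?v \<le> (m * \<delta> / \<mu>) * (3 * R)"
      using x \<delta>_nonneg \<mu>_pos by (intro mult_left_mono) auto
    then show ?thesis by (simp add: mult_ac)
  qed
  \<comment> \<open>Nonnegativity allows the factor 3 in \<open>bias\<close> to be relaxed to 4,
    which doubles to the 8 of the final bound.\<close>
  have R0: "0 \<le> \<delta> * m * R / \<mu>"
    using order_trans[OF norm_ge_zero x] \<delta>_nonneg \<mu>_pos by (intro divide_nonneg_pos mult_nonneg_nonneg) auto
  have "(LINT s|\<sigma>. (norm (x - h *\<^sub>R G x s - xstar))\<^sup>2)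
      = (norm ?v)\<^sup>2 - 2 * h * (LINT s|\<sigma>. G x s \<bullet> ?v) + h\<^sup>2 * (LINT s|\<sigma>. (norm (G x s))\<^sup>2)"
    unfolding expand using integrable_G_inner integrable_norm_G_square \<sigma>.prob_space by simp
  also have "\<dots> \<le> (norm ?v)\<^sup>2 - 2 * h * (\<Delta> - L * \<mu>\<^sup>2 / 2 - 4 * (\<delta> * m * R / \<mu>))
      + h\<^sup>2 * (8 * m * L * \<Delta> + A)"
  proof (intro add_mono diff_mono mult_left_mono order.refl)
    show "\<Delta> - L * \<mu>\<^sup>2 / 2 - 4 * (\<delta> * m * R / \<mu>) \<le> (LINT s|\<sigma>. G x s \<bullet> ?v)"
      using integral_G_inner_lower[of x xstar] bias R0 unfolding \<Delta>_def by linarith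
    show "(LINT s|\<sigma>. (norm (G x s))\<^sup>2) \<le> 8 * m * L * \<Delta> + A"
      using integral_norm_G_square_le[of x] unfolding \<Delta>_def A_def by linarith
  qed (use h0 in auto)
  \<comment> \<open>By the choice of \<open>h\<close> the second moment gives back
    \<open>h * \<Delta>\<close>, half of the first-order decrease
    \<open>2 * h * \<Delta>\<close>.\<close>
  also have "h\<^sup>2 * (8 * m * L * \<Delta> + A) = h * ((h * (8 * m * L)) * \<Delta>) + h * (h * A)"
    by (simp add: power2_eq_square algebra_simps)
  also have "\<dots> = h * \<Delta> + h * (h * A)" unfolding h1 by simp
  \<comment> \<open>The term \<open>m * L * \<mu>\<^sup>2 / 8\<close> joins the smoothing bias
    \<open>L * \<mu>\<^sup>2\<close> to form \<open>\<mu>\<^sup>2 * L * (m + 8) / 8\<close>.\<close>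
  also have "h * A = m * L * \<mu>\<^sup>2 / 8 + \<delta>\<^sup>2 * m / (L * \<mu>\<^sup>2)"
    unfolding A_def h using L_pos \<mu>_pos by (simp add: field_simps power2_eq_square)
  finally show "(LINT s|\<sigma>. (norm (x - h *\<^sub>R G x s - xstar))\<^sup>2)
      \<le> (norm ?v)\<^sup>2 - h * (f x - f xstar)
        + h * (\<mu>\<^sup>2 * L * (m + 8) / 8 + 8 * \<delta> * m * R / \<mu> + \<delta>\<^sup>2 * m / (L * \<mu>\<^sup>2))"
    by (simp add: \<Delta>_def add_divide_distrib algebra_simps)
qed

end

section \<open>The iteration\<close>

locale zeroth_order_method = inexact_oracle f \<delta>err gradf xstar L \<delta> \<mu> m + prob_space \<Omega>
  for f \<delta>err :: "real ^ 'm \<Rightarrow> real" and gradf :: "real ^ 'm \<Rightarrow> real ^ 'm"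
    and xstar :: "real ^ 'm" and L \<delta> \<mu> m :: real and \<Omega> :: "'w measure" +
  fixes x0 :: "real ^ 'm" and R h :: real and X :: "(real ^ 'm) set"
    and s x :: "nat \<Rightarrow> 'w \<Rightarrow> real ^ 'm"
  assumes x0_dist: "norm (x0 - xstar) \<le> R"
    and h_eq: "h = 1 / (8 * m * L)"
    and X_eq: "X = {y. norm (y - x0) \<le> 2 * R}"
    and s_indep: "indep_vars (\<lambda>_. borel) s UNIV"
    and s_uniform: "\<And>k. distr \<Omega> borel (s k) = uniform_sphere"
    and x_0: "\<And>\<omega>. \<omega> \<in> space \<Omega> \<Longrightarrow> x 0 \<omega> = x0"
    and x_Suc: "\<And>k \<omega>. \<omega> \<in> space \<Omega> \<Longrightarrow> x (Suc k) \<omega> = closest_point X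
        (x k \<omega> - h *\<^sub>R zo_gradient \<mu> (\<lambda>y. f y + \<delta>err y) (x k \<omega>) (s k \<omega>))"
begin

section \<open>The iterates as functions of the directions\<close>

definition step :: "real ^ 'm \<Rightarrow> real ^ 'm \<Rightarrow> real ^ 'm" where
  "step y u = closest_point X (y - h *\<^sub>R G y u)"

text \<open>A deterministic form of the method. Only the entries of \<open>w\<close> below the index
  are read, which makes the independence of \<open>x k\<close> and \<open>s k\<close>
  accessible.\<close>

fun iterate :: "nat \<Rightarrow> (nat \<Rightarrow> real ^ 'm) \<Rightarrow> real ^ 'm" where
  "iterate 0 w = x0"
| "iterate (Suc k) w = step (iterate k w) (w k)"

text \<open>The error level that does not decay with the number of steps;
  \<open>2 * C / \<tau>\<close> is the \<open>\<delta>\<^sub>\<mu>\<close> of the strongly convex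
  case.\<close>

definition C where
  "C = \<mu>\<^sup>2 * L * (m + 8) / 8 + 8 * \<delta> * m * R / \<mu> + \<delta>\<^sup>2 * m / (L * \<mu>\<^sup>2)"

lemma R_nonneg: "R \<ge> 0"
  using x0_dist norm_ge_zero[of "x0 - xstar"] by linarith

lemma h_pos: "h > 0"
  using L_pos by (simp add: h_eq)

lemma X_cball: "X = cball x0 (2 * R)"
  by (auto simp: X_eq dist_norm norm_minus_commute)

lemma X_props [simp]: "closed X" "convex X" "X \<noteq> {}" "compact X"
  using R_nonneg by (auto simp: X_cball)

lemma xstar_in_X: "xstar \<in> X"
  using x0_dist R_nonneg by (simp add: X_eq norm_minus_commute)

lemma x0_in_X: "x0 \<in> X"
  using R_nonneg by (simp add: X_eq)

lemma dist_xstar: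
  assumes "y \<in> X"
  shows "norm (y - xstar) \<le> 3 * R"
  using assms x0_dist norm_triangle_ineq[of "y - x0" "x0 - xstar"] by (simp add: X_eq)

lemma step_in_X: "step y u \<in> X"
  unfolding step_def by (rule closest_point_in_set) auto

lemma iterate_in_X: "iterate k w \<in> X"
  by (cases k) (auto simp: x0_in_X step_in_X)

text \<open>Projection onto the closed convex set \<open>X\<close> is nonexpansive and fixes
  \<open>xstar\<close>.\<close>

lemma norm_step_le: "norm (step y u - xstar) \<le> norm (y - h *\<^sub>R G y u - xstar)"
  using closest_point_lipschitz[of X "y - h *\<^sub>R G y u" xstar] closest_point_self[OF xstar_in_X]
  by (simp add: step_def dist_norm)

lemma measurable_closest_point [measurable]: "closest_point X \<in> borel_measurable borel"
  by (intro borel_measurable_continuous_onI continuous_on_closest_point) auto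

lemma measurable_step [measurable]:
  "(\<lambda>(y, u). step y u) \<in> borel_measurable (borel \<Otimes>\<^sub>M borel)"
  unfolding step_def by measurable

lemma measurable_iterate:
  "k \<le> n \<Longrightarrow> iterate k \<in> borel_measurable (PiM {..<n} (\<lambda>_. borel))"
proof (induction k)
  case 0
  have "iterate 0 = (\<lambda>_. x0)" by auto
  then show ?case by simp
next
  case (Suc k)
  have [measurable]: "iterate k \<in> borel_measurable (PiM {..<n} (\<lambda>_. borel))"
    using Suc by simp
  have [measurable]: "(\<lambda>w. w k) \<in> borel_measurable (PiM {..<n} (\<lambda>_. borel))"
    using Suc.prems by (intro measurable_component_singleton) auto
  have "iterate (Suc k) = (\<lambda>w. step (iterate k w) (w k))" by auto
  then show ?case by simp
qed

lemma iterate_restrict: "k \<le> n \<Longrightarrow> iterate k (restrict w {..<n}) = iterate k w"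
  by (induction k) auto

lemma x_eq_iterate: "\<omega> \<in> space \<Omega> \<Longrightarrow> x k \<omega> = iterate k (\<lambda>i. s i \<omega>)"
  by (induction k) (auto simp: x_0 x_Suc step_def)

lemma x_in_X: "\<omega> \<in> space \<Omega> \<Longrightarrow> x k \<omega> \<in> X"
  by (simp add: x_eq_iterate iterate_in_X)

lemma measurable_s [measurable]: "s k \<in> borel_measurable \<Omega>"
  using s_indep unfolding indep_vars_def by auto

text \<open>\<open>x k\<close> is determined by the directions with index below \<open>k\<close>,
  hence independent of \<open>s k\<close>, and the joint law is a product.\<close>

lemma measurable_x [measurable]: "x k \<in> borel_measurable \<Omega>"
  and joint_distribution: "distr \<Omega> (borel \<Otimes>\<^sub>M borel) (\<lambda>\<omega>. (x k \<omega>, s k \<omega>))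
    = distr \<Omega> borel (x k) \<Otimes>\<^sub>M distr \<Omega> borel (s k)"
proof -
  \<comment> \<open>The restriction exhibits a function of a block of directions disjoint from
    \<open>{k}\<close>. The recursion is assumed only on \<open>space \<Omega>\<close>, so
    \<open>Y\<close> and \<open>x k\<close> are identified only there, and the results are
    transferred by congruence.\<close>
  define Y where "Y = iterate k \<circ> (\<lambda>\<omega>. restrict (\<lambda>i. s i \<omega>) {..<k})"
  have Y: "Y \<omega> = x k \<omega>" if "\<omega> \<in> space \<Omega>" for \<omega>
    using that by (simp add: Y_def x_eq_iterate iterate_restrict)
  have "indep_var (PiM {..<k} (\<lambda>_. borel)) (\<lambda>\<omega>. restrict (\<lambda>i. s i \<omega>) {..<k})
      (PiM {k} (\<lambda>_. borel)) (\<lambda>\<omega>. restrict (\<lambda>i. s i \<omega>) {k})"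
    by (rule indep_var_restrict[OF s_indep]) auto
  then have "indep_var borel Y borel ((\<lambda>w. w k) \<circ> (\<lambda>\<omega>. restrict (\<lambda>i. s i \<omega>) {k}))"
    unfolding Y_def by (rule indep_var_compose) (auto intro: measurable_iterate)
  moreover have "(\<lambda>w. w k) \<circ> (\<lambda>\<omega>. restrict (\<lambda>i. s i \<omega>) {k}) = s k" by auto
  ultimately have indep: "indep_var borel Y borel (s k)" by simp
  then have "Y \<in> borel_measurable \<Omega>" by (simp add: indep_var_distribution_eq)
  then show "x k \<in> borel_measurable \<Omega>"
    using measurable_cong[of \<Omega> Y "x k" borel] Y by simp
  have "distr \<Omega> borel Y = distr \<Omega> borel (x k)"
    by (rule distr_cong) (auto simp: Y)
  moreover have "distr \<Omega> (borel \<Otimes>\<^sub>M borel) (\<lambda>\<omega>. (Y \<omega>, s k \<omega>))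
      = distr \<Omega> (borel \<Otimes>\<^sub>M borel) (\<lambda>\<omega>. (x k \<omega>, s k \<omega>))"
    by (rule distr_cong) (auto simp: Y)
  ultimately show "distr \<Omega> (borel \<Otimes>\<^sub>M borel) (\<lambda>\<omega>. (x k \<omega>, s k \<omega>))
      = distr \<Omega> borel (x k) \<Otimes>\<^sub>M distr \<Omega> borel (s k)"
    using indep by (simp add: indep_var_distribution_eq)
qed

section \<open>The recursion for the expected squared distance\<close>

text \<open>The iterates stay in the compact set \<open>X\<close>, where a continuous function is
  bounded.\<close>

lemma integrable_on_X:
  assumes "continuous_on UNIV F"
  shows "integrable \<Omega> (\<lambda>\<omega>. F (x k \<omega>) :: real)"
proof -
  have "bounded (F ` X)"
    by (intro compact_imp_bounded compact_continuous_image continuous_on_subset[OF assms]) auto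
  then obtain B where "\<And>y. y \<in> X \<Longrightarrow> \<bar>F y\<bar> \<le> B"
    unfolding bounded_iff real_norm_def by blast
  then show ?thesis
    using borel_measurable_continuous_onI[OF assms]
    by (intro integrable_const_bound[of _ B]) (auto simp: x_in_X)
qed

lemma integrable_f_x: "integrable \<Omega> (\<lambda>\<omega>. f (x k \<omega>))"
  by (rule integrable_on_X[OF continuous_f])

lemma integrable_dist_x: "integrable \<Omega> (\<lambda>\<omega>. (norm (x k \<omega> - xstar))\<^sup>2)"
  by (rule integrable_on_X) (intro continuous_intros)

lemma expectation_step_le:
  assumes "y \<in> X"
  shows "(LINT u|\<sigma>. (norm (step y u - xstar))\<^sup>2)
    \<le> (norm (y - xstar))\<^sup>2 - h * (f y - f xstar) + h * C"
proof -
  have "(LINT u|\<sigma>. (norm (step y u - xstar))\<^sup>2) \<le> (LINT u|\<sigma>. (norm (y - h *\<^sub>R G y u - xstar))\<^sup>2)"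
  proof (rule integral_mono)
    show "integrable \<sigma> (\<lambda>u. (norm (step y u - xstar))\<^sup>2)"
      by (intro integrable_sphere[of _ "(3 * R)\<^sup>2"])
        (auto simp only: abs_of_nonneg[OF zero_le_power2]
          intro!: power_mono dist_xstar[OF step_in_X] norm_ge_zero, measurable)
    show "(norm (step y u - xstar))\<^sup>2 \<le> (norm (y - h *\<^sub>R G y u - xstar))\<^sup>2" for u
      by (intro power_mono norm_step_le) auto
  qed (rule expected_gradient_step[OF h_eq dist_xstar[OF assms]])
  also have "\<dots> \<le> (norm (y - xstar))\<^sup>2 - h * (f y - f xstar) + h * C"
    unfolding C_def by (rule expected_gradient_step[OF h_eq dist_xstar[OF assms]])
  finally show ?thesis .
qed

text \<open>Under the product law, Fubini allows averaging over \<open>s k\<close> first with the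
  current iterate fixed, where the one-step bound holds, and then over the law of
  \<open>x k\<close>.\<close>

lemma expected_descent:
  "expectation (\<lambda>\<omega>. (norm (x (Suc k) \<omega> - xstar))\<^sup>2)
    \<le> expectation (\<lambda>\<omega>. (norm (x k \<omega> - xstar))\<^sup>2) - h * (expectation (\<lambda>\<omega>. f (x k \<omega>)) - f xstar) + h * C"
proof -
  define \<nu> where "\<nu> = distr \<Omega> borel (x k)"
  interpret \<nu>: prob_space \<nu> unfolding \<nu>_def by (rule prob_space_distr) measurable
  interpret pair_sigma_finite \<nu> \<sigma> ..
  interpret P: prob_space "\<nu> \<Otimes>\<^sub>M \<sigma>"
    by (rule prob_space_pair) unfold_locales
  have sets_\<nu> [measurable_cong, simp]: "sets \<nu> = sets borel" by (simp add: \<nu>_def)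
  have joint: "distr \<Omega> (borel \<Otimes>\<^sub>M borel) (\<lambda>\<omega>. (x k \<omega>, s k \<omega>)) = \<nu> \<Otimes>\<^sub>M \<sigma>"
    by (simp add: joint_distribution \<nu>_def s_uniform)
  let ?F = "\<lambda>p. (norm (step (fst p) (snd p) - xstar))\<^sup>2"
  have [measurable]: "(\<lambda>p. step (fst p) (snd p)) \<in> borel_measurable (borel \<Otimes>\<^sub>M borel)"
    using measurable_step by (simp add: case_prod_beta')
  have F_le: "?F p \<le> (3 * R)\<^sup>2" for p
    using dist_xstar[OF step_in_X] by (intro power_mono) auto
  have F_int: "integrable (\<nu> \<Otimes>\<^sub>M \<sigma>) ?F"
    by (rule P.integrable_const_bound[of _ "(3 * R)\<^sup>2"]) (use F_le in auto)
  let ?H = "\<lambda>y. (norm (y - xstar))\<^sup>2 - h * (f y - f xstar) + h * C"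
  have H_int: "integrable \<Omega> (\<lambda>\<omega>. ?H (x k \<omega>))"
    by (intro Bochner_Integration.integrable_add Bochner_Integration.integrable_diff
      integrable_dist_x integrable_mult_right integrable_f_x) auto
  have "expectation (\<lambda>\<omega>. (norm (x (Suc k) \<omega> - xstar))\<^sup>2) = expectation (\<lambda>\<omega>. ?F (x k \<omega>, s k \<omega>))"
    by (intro Bochner_Integration.integral_cong) (auto simp: x_Suc step_def)
  also have "\<dots> = integral\<^sup>L (\<nu> \<Otimes>\<^sub>M \<sigma>) ?F"
    unfolding joint[symmetric] by (subst integral_distr) auto
  also have "\<dots> = (LINT y|\<nu>. LINT u|\<sigma>. ?F (y, u))"
    using integral_fst'[OF F_int] by simp
  also have "\<dots> \<le> (LINT y|\<nu>. ?H y)"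
  proof (rule integral_mono_AE)
    show "integrable \<nu> (\<lambda>y. LINT u|\<sigma>. ?F (y, u))"
      by (rule integrable_fst'[OF F_int])
    show "integrable \<nu> ?H"
      unfolding \<nu>_def using H_int by (subst integrable_distr_eq) auto
    \<comment> \<open>The one-step bound is available only on \<open>X\<close>, which carries the
      whole law of \<open>x k\<close>.\<close>
    have "AE \<omega> in \<Omega>. x k \<omega> \<in> X" by (rule AE_I2) (rule x_in_X)
    then have "AE y in \<nu>. y \<in> X"
      unfolding \<nu>_def by (subst AE_distr_iff) (auto simp: X_cball)
    then show "AE y in \<nu>. (LINT u|\<sigma>. ?F (y, u)) \<le> ?H y"
      by eventually_elim (simp add: expectation_step_le)
  qed
  also have "\<dots> = expectation (\<lambda>\<omega>. ?H (x k \<omega>))"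
    unfolding \<nu>_def by (rule integral_distr) auto
  also have "\<dots> = expectation (\<lambda>\<omega>. (norm (x k \<omega> - xstar))\<^sup>2)
      - h * (expectation (\<lambda>\<omega>. f (x k \<omega>)) - f xstar) + h * C"
    using integrable_dist_x[of k] integrable_f_x[of k] prob_space by simp
  finally show ?thesis .
qed

lemma expectation_x_0:
  "expectation (\<lambda>\<omega>. f (x 0 \<omega>)) = f x0"
  "expectation (\<lambda>\<omega>. (norm (x 0 \<omega> - xstar))\<^sup>2) \<le> R\<^sup>2"
proof -
  have "expectation (\<lambda>\<omega>. F (x 0 \<omega>)) = F x0" for F :: "real ^ 'm \<Rightarrow> real"
  proof -
    have "expectation (\<lambda>\<omega>. F (x 0 \<omega>)) = expectation (\<lambda>_. F x0)"
      by (intro Bochner_Integration.integral_cong) (auto simp: x_0)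
    then show ?thesis using prob_space by simp
  qed
  from this[of f] this[of "\<lambda>y. (norm (y - xstar))\<^sup>2"]
  show "expectation (\<lambda>\<omega>. f (x 0 \<omega>)) = f x0"
    "expectation (\<lambda>\<omega>. (norm (x 0 \<omega> - xstar))\<^sup>2) \<le> R\<^sup>2"
    using x0_dist by (auto intro: power_mono)
qed

section \<open>Convergence rates\<close>

text \<open>The descent inequalities telescope. The last squared distance is dropped as nonnegative,
  the first is at most \<open>R^2\<close>, and dividing by \<open>h\<close> multiplies by
  \<open>8 * m * L\<close>.\<close>

theorem average_bound:
  "1 / real (M + 1) * (\<Sum>i=0..M. expectation (\<lambda>\<omega>. f (x i \<omega>)) - f xstar)
    \<le> 8 * m * L * R\<^sup>2 / real (M + 1) + C"
proof -
  define r where "r k = expectation (\<lambda>\<omega>. (norm (x k \<omega> - xstar))\<^sup>2)" for k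
  define d where "d k = expectation (\<lambda>\<omega>. f (x k \<omega>)) - f xstar" for k
  have "h * (\<Sum>i=0..M. d i) \<le> r 0 - r (Suc M) + h * (real (M + 1) * C)"
  proof (induction M)
    case 0
    then show ?case using expected_descent[of 0] by (simp add: r_def d_def)
  next
    case (Suc M)
    have "h * d (Suc M) \<le> r (Suc M) - r (Suc (Suc M)) + h * C"
      using expected_descent[of "Suc M"] by (simp add: r_def d_def)
    with Suc show ?case by (simp add: algebra_simps)
  qed
  moreover have "r (Suc M) \<ge> 0" unfolding r_def by simp
  moreover have "r 0 \<le> R\<^sup>2" unfolding r_def by (rule expectation_x_0)
  ultimately have "h * (\<Sum>i=0..M. d i) \<le> R\<^sup>2 + h * (real (M + 1) * C)" by linarith
  then have "(8 * m * L) * (h * (\<Sum>i=0..M. d i)) \<le> (8 * m * L) * (R\<^sup>2 + h * (real (M + 1) * C))"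
    using L_pos by (intro mult_left_mono) auto
  moreover have h1: "8 * m * L * h = 1" using L_pos by (simp add: h_eq)
  moreover have "(8 * m * L) * (h * (\<Sum>i=0..M. d i)) = (8 * m * L * h) * (\<Sum>i=0..M. d i)"
    by (simp add: mult.assoc)
  moreover have "(8 * m * L) * (R\<^sup>2 + h * (real (M + 1) * C))
      = 8 * m * L * R\<^sup>2 + (8 * m * L * h) * (real (M + 1) * C)"
    by (simp add: algebra_simps)
  ultimately have "(\<Sum>i=0..M. d i) \<le> 8 * m * L * R\<^sup>2 + real (M + 1) * C"
    by simp
  then have "(\<Sum>i=0..M. d i) / real (M + 1) \<le> (8 * m * L * R\<^sup>2 + real (M + 1) * C) / real (M + 1)"
    by (intro divide_right_mono) auto
  also have "\<dots> = 8 * m * L * R\<^sup>2 / real (M + 1) + C"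
    by (simp add: add_divide_distrib)
  finally show ?thesis unfolding d_def[symmetric] by simp
qed

text \<open>Quadratic growth around \<open>xstar\<close> turns the descent inequality into an affine
  contraction for the mean squared distance. Smoothness at \<open>xstar\<close> then converts that
  distance back to function values, whence the factor \<open>L / 2\<close>.\<close>

theorem strongly_convex_bound:
  assumes \<tau>: "\<tau> > 0"
    and strong: "\<And>y z. f y \<ge> f z + gradf z \<bullet> (y - z) + \<tau> / 2 * (norm (y - z))\<^sup>2"
  shows "expectation (\<lambda>\<omega>. f (x M \<omega>)) - f xstar
    \<le> 1 / 2 * L * (2 * C / \<tau> + (1 - \<tau> / (16 * m * L)) ^ M * (R\<^sup>2 - 2 * C / \<tau>))"
proof -
  define r where "r k = expectation (\<lambda>\<omega>. (norm (x k \<omega> - xstar))\<^sup>2)" for k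
  define q where "q = 1 - \<tau> / (16 * m * L)"
  define \<Delta> where "\<Delta> = 2 * C / \<tau>"
  have q_eq: "q = 1 - h * \<tau> / 2" using L_pos by (simp add: q_def h_eq)
  \<comment> \<open>Comparing the lower and upper quadratic bounds along a unit vector. This yields
    \<open>0 \<le> q\<close>, so the induction hypothesis may be multiplied by
    \<open>q\<close>.\<close>
  have "\<tau> \<le> L"
  proof -
    obtain b :: "real ^ 'm" where b: "norm b = 1" using vector_choose_size[of 1] by auto
    have "\<tau> / 2 * (norm b)\<^sup>2 \<le> L / 2 * (norm b)\<^sup>2"
      using strong[of 0 b] quadratic_bound[of b 0] unfolding diff_zero by linarith
    then show ?thesis using b by simp
  qed
  moreover have "L \<le> 16 * m * L"
  proof -
    have "1 \<le> m" by (simp add: m_eq Suc_le_eq)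
    then have "1 * L \<le> 16 * m * L" using L_pos by (intro mult_right_mono) auto
    then show ?thesis by simp
  qed
  ultimately have "\<tau> \<le> 16 * m * L" by (rule order_trans)
  then have q0: "0 \<le> q" using L_pos by (simp add: q_def divide_le_eq)
  have growth: "f y - f xstar \<ge> \<tau> / 2 * (norm (y - xstar))\<^sup>2" for y
    using strong[of xstar y] by (simp add: gradf_xstar)
  have lower: "\<tau> / 2 * r k \<le> expectation (\<lambda>\<omega>. f (x k \<omega>)) - f xstar" for k
  proof -
    have "\<tau> / 2 * r k = expectation (\<lambda>\<omega>. \<tau> / 2 * (norm (x k \<omega> - xstar))\<^sup>2)"
      unfolding r_def using integrable_dist_x by simp
    also have "\<dots> \<le> expectation (\<lambda>\<omega>. f (x k \<omega>) - f xstar)"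
      by (intro integral_mono growth integrable_mult_right integrable_dist_x
        Bochner_Integration.integrable_diff integrable_f_x) simp
    also have "\<dots> = expectation (\<lambda>\<omega>. f (x k \<omega>)) - f xstar"
      using integrable_f_x prob_space by simp
    finally show ?thesis .
  qed
  have rec: "r (Suc k) \<le> q * r k + h * C" for k
  proof -
    have "h * (\<tau> / 2 * r k) \<le> h * (expectation (\<lambda>\<omega>. f (x k \<omega>)) - f xstar)"
      using h_pos by (intro mult_left_mono lower) auto
    then show ?thesis
      using expected_descent[of k] unfolding r_def[symmetric] q_eq by (simp add: algebra_simps)
  qed
  \<comment> \<open>Thus \<Delta> is the fixed point of the affine recursion, and the excess over it
    shrinks by the factor \<open>q\<close> in each step.\<close>
  have hC: "h * C = (1 - q) * \<Delta>" using \<tau> by (simp add: q_eq \<Delta>_def)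
  have "r k \<le> \<Delta> + q ^ k * (R\<^sup>2 - \<Delta>)" for k
  proof (induction k)
    case 0
    then show ?case using expectation_x_0 by (simp add: r_def)
  next
    case (Suc k)
    have "r (Suc k) \<le> q * r k + (1 - q) * \<Delta>" using rec[of k] hC by simp
    also have "\<dots> \<le> q * (\<Delta> + q ^ k * (R\<^sup>2 - \<Delta>)) + (1 - q) * \<Delta>"
      using mult_left_mono[OF Suc q0] by simp
    finally show ?case by (simp add: algebra_simps)
  qed
  then have rM: "L / 2 * r M \<le> L / 2 * (\<Delta> + q ^ M * (R\<^sup>2 - \<Delta>))"
    using L_pos by (intro mult_left_mono) auto
  have "expectation (\<lambda>\<omega>. f (x M \<omega>)) - f xstar = expectation (\<lambda>\<omega>. f (x M \<omega>) - f xstar)"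
    using integrable_f_x prob_space by simp
  also have "\<dots> \<le> expectation (\<lambda>\<omega>. L / 2 * (norm (x M \<omega> - xstar))\<^sup>2)"
  proof (rule integral_mono)
    show "f (x M \<omega>) - f xstar \<le> L / 2 * (norm (x M \<omega> - xstar))\<^sup>2" for \<omega>
      using f_upper[of "x M \<omega>"] by linarith
  qed (intro Bochner_Integration.integrable_diff integrable_f_x integrable_mult_right
      integrable_dist_x integrable_const)+
  also have "\<dots> = L / 2 * r M"
    unfolding r_def using integrable_dist_x by simp
  finally show ?thesis using rM unfolding q_def \<Delta>_def by simp
qed

end

theorem theorem1:
  fixes f \<delta>err :: "real ^ 'm \<Rightarrow> real"
    and gradf :: "real ^ 'm \<Rightarrow> real ^ 'm"
    and xstar x0 :: "real ^ 'm"
    and L \<delta> \<mu> R h :: real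
    and X :: "(real ^ 'm) set"
    and \<Omega> :: "'w measure"
    and s x :: "nat \<Rightarrow> 'w \<Rightarrow> real ^ 'm"
    and \<psi> :: "nat \<Rightarrow> real"
  assumes convex: "convex_on UNIV f"
    and gradient: "\<And>y. GDERIV f y :> gradf y"
    and L_pos: "L > 0"
    and lipschitz_gradient: "L-lipschitz_on UNIV gradf"
    and minimum: "\<And>y. f xstar \<le> f y"
    and \<delta>_nonneg: "\<delta> \<ge> 0"
    and \<delta>err_measurable: "\<delta>err \<in> borel_measurable borel"
    and \<delta>err_bound: "\<And>y. \<bar>\<delta>err y\<bar> \<le> \<delta>"
    and \<mu>_pos: "\<mu> > 0"
    and R_pos: "R > 0"
    and x0_dist: "norm (x0 - xstar) \<le> R"
    and h_def: "h = 1 / (8 * real CARD('m) * L)"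
    and X_def: "X = {y. norm (y - x0) \<le> 2 * R}"
    and prob: "prob_space \<Omega>"
    and s_indep: "prob_space.indep_vars \<Omega> (\<lambda>_. borel) s UNIV"
    and s_uniform: "\<And>k. distr \<Omega> borel (s k) = uniform_sphere"
    and x_0: "\<And>\<omega>. \<omega> \<in> space \<Omega> \<Longrightarrow> x 0 \<omega> = x0"
    and x_Suc: "\<And>k \<omega>. \<omega> \<in> space \<Omega> \<Longrightarrow>
      x (Suc k) \<omega> = closest_point X
        (x k \<omega> - h *\<^sub>R zo_gradient \<mu> (\<lambda>y. f y + \<delta>err y) (x k \<omega>) (s k \<omega>))"
    and \<psi>_0: "\<psi> 0 = f x0"
    and \<psi>_pos: "\<And>k. k \<ge> 1 \<Longrightarrow> \<psi> k = prob_space.expectation \<Omega> (\<lambda>\<omega>. f (x k \<omega>))"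
  shows "(\<forall>M::nat.
      1 / real (M + 1) * (\<Sum>i=0..M. \<psi> i - f xstar)
        \<le> 8 * real CARD('m) * L * R\<^sup>2 / real (M + 1)
          + \<mu>\<^sup>2 * L * (real CARD('m) + 8) / 8
          + 8 * \<delta> * real CARD('m) * R / \<mu>
          + \<delta>\<^sup>2 * real CARD('m) / (L * \<mu>\<^sup>2))
    \<and> (\<forall>\<tau>::real. \<tau> > 0 \<longrightarrow>
        (\<forall>y z. f y \<ge> f z + gradf z \<bullet> (y - z) + \<tau> / 2 * (norm (y - z))\<^sup>2) \<longrightarrow>
        (let \<delta>\<^sub>\<mu> = \<mu>\<^sup>2 * L * (real CARD('m) + 8) / (4 * \<tau>)
                + 16 * real CARD('m) * \<delta> * R / (\<tau> * \<mu>)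
                + 2 * real CARD('m) * \<delta>\<^sup>2 / (\<tau> * \<mu>\<^sup>2 * L)
         in \<forall>M::nat. \<psi> M - f xstar
              \<le> 1 / 2 * L * (\<delta>\<^sub>\<mu>
                  + (1 - \<tau> / (16 * real CARD('m) * L)) ^ M * (R\<^sup>2 - \<delta>\<^sub>\<mu>))))"
proof -
  interpret prob_space \<Omega> by (rule prob)
  interpret zeroth_order_method f \<delta>err gradf xstar L \<delta> \<mu> "real CARD('m)" \<Omega> x0 R h X s x
  proof unfold_locales
    show "indep_vars (\<lambda>_. borel) s UNIV" by (rule s_indep)
  qed (fact assms refl)+
  \<comment> \<open>The value at index 0 is prescribed separately; as \<open>x 0\<close> is
    constant, the expectation formula covers it too.\<close>
  have \<psi>: "\<psi> k = expectation (\<lambda>\<omega>. f (x k \<omega>))" for k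
    using \<psi>_0 \<psi>_pos[of k] expectation_x_0(1) by (cases k) auto
  show ?thesis
  proof (intro conjI allI impI)
    fix M
    show "1 / real (M + 1) * (\<Sum>i=0..M. \<psi> i - f xstar)
        \<le> 8 * real CARD('m) * L * R\<^sup>2 / real (M + 1)
          + \<mu>\<^sup>2 * L * (real CARD('m) + 8) / 8
          + 8 * \<delta> * real CARD('m) * R / \<mu>
          + \<delta>\<^sup>2 * real CARD('m) / (L * \<mu>\<^sup>2)"
      using average_bound[of M] unfolding \<psi> C_def by (simp only: add.assoc)
  next
    fix \<tau> :: real
    assume "\<tau> > 0" and "\<forall>y z. f y \<ge> f z + gradf z \<bullet> (y - z) + \<tau> / 2 * (norm (y - z))\<^sup>2"
    then have bound: "\<psi> M - f xstar \<le> 1 / 2 * L * (2 * C / \<tau>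
        + (1 - \<tau> / (16 * real CARD('m) * L)) ^ M * (R\<^sup>2 - 2 * C / \<tau>))" for M
      unfolding \<psi> by (intro strongly_convex_bound) auto
    have "\<mu>\<^sup>2 * L * (real CARD('m) + 8) / (4 * \<tau>) + 16 * real CARD('m) * \<delta> * R / (\<tau> * \<mu>)
        + 2 * real CARD('m) * \<delta>\<^sup>2 / (\<tau> * \<mu>\<^sup>2 * L) = 2 * C / \<tau>"
      unfolding C_def using \<open>\<tau> > 0\<close> L_pos \<mu>_pos by (simp add: field_simps)
    then show "let \<delta>\<^sub>\<mu> = \<mu>\<^sup>2 * L * (real CARD('m) + 8) / (4 * \<tau>)
                + 16 * real CARD('m) * \<delta> * R / (\<tau> * \<mu>)
                + 2 * real CARD('m) * \<delta>\<^sup>2 / (\<tau> * \<mu>\<^sup>2 * L)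
         in \<forall>M::nat. \<psi> M - f xstar
              \<le> 1 / 2 * L * (\<delta>\<^sub>\<mu>
                  + (1 - \<tau> / (16 * real CARD('m) * L)) ^ M * (R\<^sup>2 - \<delta>\<^sub>\<mu>))"
      unfolding Let_def using bound by simp
  qed
qed

end
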